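(* Let $(X,\mathcal{B},\nu)$ be an atomless probability space. Let $G$ be a locally compact Hausdorff group acting on $X$ by measure-preserving transformations, and assume that the corresponding Koopman representation $\pi_0$ of $G$ on $L^2_0(X,\nu)$ is strongly continuous. Assume that for each compact symmetric neighborhood $S$ of the identity $e\in G$ there exist a neighborhood $F$ of $e$ in $G$ and a sequence $(B_n)_{n\in\mathbb{N}}$ of measurable subsets of $X$ such that: (1) for all $n\in\mathbb{N}$, $\nu(B_n)>0$; (2) for all $n\in\mathbb{N}$, $\inf\{\nu(B) : B\in\mathcal{B},\ S^nB_n\subset B\}<\frac12$; (3) $\limsup_{n\to\infty}\left(\inf_{g\in F}\frac{\nu(gB_n\cap B_n)}{\nu(B_n)}\right)^{1/n}\geq 1$. Then any finite positive regular Borel measure $\mu$ on $G$ satisfies $\|\pi_0(\mu)\|\geq\|\lambda_G(\mu)\|$.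
   Context: A measure space $(X,\nu)$ is atomless if it has no atom, an atom being a measurable set $A$ with $\nu(A)>0$ such that every measurable $B\subset A$ has $\nu(B)\in\{0,\nu(A)\}$. For a measure-preserving action of $G$ on a probability space $(X,\nu)$, $L^2_0(X,\nu)$ is the subspace of $L^2(X,\nu)$ of functions of zero integral, and the Koopman representation $\pi_0:G\to U(L^2_0(X,\nu))$ is $(\pi_0(g)\phi)(x)=\phi(g^{-1}x)$. The left regular representation $\lambda_G$ of $G$ on $L^2(G,\mu_G)$ ($\mu_G$ a left Haar measure) is $(\lambda_G(g)\phi)(h)=\phi(g^{-1}h)$. For a strongly continuous unitary representation $\pi$ of $G$ on a Hilbert space $\mathcal{H}$ and a finite regular Borel measure $\mu$ on $G$, $\pi(\mu)$ is the unique bounded operator on $\mathcal{H}$ with $\langle\pi(\mu)\xi,\eta\rangle=\int_G\langle\pi(g)\xi,\eta\rangle\,\mathrm{d}\mu(g)$ for all $\xi,\eta\in\mathcal{H}$; $\|\cdot\|$ is the operator norm. $S^n$ denotes the set of products of $n$ elements of $S$, and $S^nB_n=\{sx : s\in S^n, x\in B_n\}$ (which need not be measurable). *)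

theory Defs
  imports "HOL-Probability.Probability"
begin

section \<open>The Hilbert space of square-integrable functions\<close>

text \<open>The space is a genuine quotient: its elements are classes of square-integrable complex
  functions modulo equality almost everywhere, and the operations are lifted to classes in the
  style of HOL.Equiv\_Relations.\<close>

type_synonym 'a l2 = "('a \<Rightarrow> complex) set"

definition sq_integrable :: "'a measure \<Rightarrow> ('a \<Rightarrow> complex) set" where
  "sq_integrable M = {f \<in> borel_measurable M. integrable M (\<lambda>x. (cmod (f x))\<^sup>2)}"

definition ae_rel :: "'a measure \<Rightarrow> ('a \<Rightarrow> complex) rel" where
  "ae_rel M = {(f, g). f \<in> sq_integrable M \<and> g \<in> sq_integrable M \<and> (AE x in M. f x = g x)}"

definition L2 :: "'a measure \<Rightarrow> 'a l2 set" where
  "L2 M = sq_integrable M // ae_rel M"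

definition L2_0 :: "'a measure \<Rightarrow> 'a l2 set" where
  "L2_0 M = {\<xi> \<in> L2 M. \<forall>f\<in>\<xi>. (\<integral>x. f x \<partial>M) = 0}"

definition l2_add :: "'a measure \<Rightarrow> 'a l2 \<Rightarrow> 'a l2 \<Rightarrow> 'a l2" where
  "l2_add M \<xi> \<eta> = (\<Union>f\<in>\<xi>. \<Union>g\<in>\<eta>. ae_rel M `` {\<lambda>x. f x + g x})"

definition l2_scale :: "'a measure \<Rightarrow> complex \<Rightarrow> 'a l2 \<Rightarrow> 'a l2" where
  "l2_scale M c \<xi> = (\<Union>f\<in>\<xi>. ae_rel M `` {\<lambda>x. c * f x})"

definition l2_inner :: "'a measure \<Rightarrow> 'a l2 \<Rightarrow> 'a l2 \<Rightarrow> complex" where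
  "l2_inner M \<xi> \<eta> = the_elem (\<Union>f\<in>\<xi>. \<Union>g\<in>\<eta>. {\<integral>x. f x * cnj (g x) \<partial>M})"

definition l2_norm :: "'a measure \<Rightarrow> 'a l2 \<Rightarrow> real" where
  "l2_norm M \<xi> = sqrt (Re (l2_inner M \<xi> \<xi>))"

definition l2_dist :: "'a measure \<Rightarrow> 'a l2 \<Rightarrow> 'a l2 \<Rightarrow> real" where
  "l2_dist M \<xi> \<eta> = l2_norm M (l2_add M \<xi> (l2_scale M (-1) \<eta>))"

lemma equiv_ae_rel: "equiv (sq_integrable M) (ae_rel M)"
proof (rule equivI)
  show "ae_rel M \<subseteq> sq_integrable M \<times> sq_integrable M"
    by (auto simp: ae_rel_def)
  show "refl_on (sq_integrable M) (ae_rel M)"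
    by (auto simp: ae_rel_def refl_on_def)
  show "sym (ae_rel M)"
    by (auto simp: ae_rel_def sym_def elim: AE_mp)
  show "trans (ae_rel M)"
  proof (rule transI)
    fix f g h
    assume fg: "(f, g) \<in> ae_rel M" and gh: "(g, h) \<in> ae_rel M"
    then have "AE x in M. f x = g x" "AE x in M. g x = h x"
      by (auto simp: ae_rel_def)
    then have "AE x in M. f x = h x"
      by eventually_elim simp
    with fg gh show "(f, h) \<in> ae_rel M"
      by (simp add: ae_rel_def)
  qed
qed

lemma l2_inner_class:
  assumes f: "f \<in> sq_integrable M" and g: "g \<in> sq_integrable M"
  shows "l2_inner M (ae_rel M `` {f}) (ae_rel M `` {g}) = (\<integral>x. f x * cnj (g x) \<partial>M)"
proof -
  have "(\<integral>x. f' x * cnj (g' x) \<partial>M) = (\<integral>x. f x * cnj (g x) \<partial>M)"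
    if "f' \<in> ae_rel M `` {f}" "g' \<in> ae_rel M `` {g}" for f' g'
  proof (rule integral_cong_AE)
    have [measurable]: "f \<in> borel_measurable M" "g \<in> borel_measurable M"
        "f' \<in> borel_measurable M" "g' \<in> borel_measurable M"
      using that by (auto simp: ae_rel_def sq_integrable_def)
    show "(\<lambda>x. f' x * cnj (g' x)) \<in> borel_measurable M"
         "(\<lambda>x. f x * cnj (g x)) \<in> borel_measurable M"
      by (intro borel_measurable_times borel_measurable_continuous_on[of cnj]; simp
          add: continuous_intros)+
    have "AE x in M. f x = f' x" "AE x in M. g x = g' x"
      using that by (auto simp: ae_rel_def)
    then show "AE x in M. f' x * cnj (g' x) = f x * cnj (g x)"
      by eventually_elim simp
  qed
  moreover have "f \<in> ae_rel M `` {f}" "g \<in> ae_rel M `` {g}"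
    using f g by (auto simp: ae_rel_def)
  ultimately have "(\<Union>f'\<in>ae_rel M `` {f}. \<Union>g'\<in>ae_rel M `` {g}. {\<integral>x. f' x * cnj (g' x) \<partial>M})
      = {\<integral>x. f x * cnj (g x) \<partial>M}"
    by blast
  then show ?thesis
    by (simp add: l2_inner_def)
qed

section \<open>Operators and representations\<close>

text \<open>Below, \<open>H\<close> is a closed subspace of \<open>L2 M\<close>.\<close>

definition bounded_op :: "'a measure \<Rightarrow> 'a l2 set \<Rightarrow> ('a l2 \<Rightarrow> 'a l2) \<Rightarrow> bool" where
  "bounded_op M H T \<longleftrightarrow>
     T \<in> H \<rightarrow> H \<and>
     (\<forall>\<xi>\<in>H. \<forall>\<eta>\<in>H. T (l2_add M \<xi> \<eta>) = l2_add M (T \<xi>) (T \<eta>)) \<and>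
     (\<forall>c. \<forall>\<xi>\<in>H. T (l2_scale M c \<xi>) = l2_scale M c (T \<xi>)) \<and>
     (\<exists>C. \<forall>\<xi>\<in>H. l2_norm M (T \<xi>) \<le> C * l2_norm M \<xi>)"

definition op_norm :: "'a measure \<Rightarrow> 'a l2 set \<Rightarrow> ('a l2 \<Rightarrow> 'a l2) \<Rightarrow> real" where
  "op_norm M H T = (SUP \<xi>\<in>{\<xi>\<in>H. l2_norm M \<xi> \<le> 1}. l2_norm M (T \<xi>))"

definition strongly_continuous ::
  "'a measure \<Rightarrow> 'a l2 set \<Rightarrow> ('g::topological_space \<Rightarrow> 'a l2 \<Rightarrow> 'a l2) \<Rightarrow> bool" where
  "strongly_continuous M H \<pi> \<longleftrightarrow>
     (\<forall>\<xi>\<in>H. \<forall>g. ((\<lambda>h. l2_dist M (\<pi> h \<xi>) (\<pi> g \<xi>)) \<longlongrightarrow> 0) (at g))"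

text \<open>\<open>is_integrated_op M H \<pi> \<mu> T\<close> says that \<open>T\<close> is the operator \<open>\<pi>(\<mu>)\<close>. The defining
  identity determines \<open>T\<close> on \<open>H\<close>; its values outside \<open>H\<close> are irrelevant.\<close>

definition is_integrated_op ::
  "'a measure \<Rightarrow> 'a l2 set \<Rightarrow> ('g \<Rightarrow> 'a l2 \<Rightarrow> 'a l2) \<Rightarrow> 'g measure \<Rightarrow> ('a l2 \<Rightarrow> 'a l2) \<Rightarrow> bool" where
  "is_integrated_op M H \<pi> \<mu> T \<longleftrightarrow>
     bounded_op M H T \<and>
     (\<forall>\<xi>\<in>H. \<forall>\<eta>\<in>H. l2_inner M (T \<xi>) \<eta> = (\<integral>g. l2_inner M (\<pi> g \<xi>) \<eta> \<partial>\<mu>))"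

section \<open>Group actions\<close>

text \<open>Groups are written additively since the library's topological groups are; the class
  \<open>group_add\<close> does not assume commutativity. So \<open>0\<close> is the identity \<open>e\<close>, \<open>g + h\<close> the product
  \<open>gh\<close>, and \<open>- g\<close> the inverse of \<open>g\<close>.\<close>

definition measure_preserving_action :: "'x measure \<Rightarrow> ('g::group_add \<Rightarrow> 'x \<Rightarrow> 'x) \<Rightarrow> bool" where
  "measure_preserving_action M act \<longleftrightarrow>
     (\<forall>x\<in>space M. act 0 x = x) \<and>
     (\<forall>g h. \<forall>x\<in>space M. act (g + h) x = act g (act h x)) \<and>
     (\<forall>g. act g \<in> measurable M M \<and> distr M M (act g) = M)"

definition translation_rep ::
  "'x measure \<Rightarrow> ('g::group_add \<Rightarrow> 'x \<Rightarrow> 'x) \<Rightarrow> 'g \<Rightarrow> 'x l2 \<Rightarrow> 'x l2" where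
  "translation_rep M act g \<xi> = (\<Union>f\<in>\<xi>. ae_rel M `` {\<lambda>x. f (act (- g) x)})"

text \<open>The Koopman representation; it is used on \<open>L2_0 M\<close>.\<close>

abbreviation koopman :: "'x measure \<Rightarrow> ('g::group_add \<Rightarrow> 'x \<Rightarrow> 'x) \<Rightarrow> 'g \<Rightarrow> 'x l2 \<Rightarrow> 'x l2" where
  "koopman \<equiv> translation_rep"

abbreviation left_regular :: "'g::group_add measure \<Rightarrow> 'g \<Rightarrow> 'g l2 \<Rightarrow> 'g l2" where
  "left_regular m \<equiv> translation_rep m (+)"

definition product_power :: "'g::monoid_add set \<Rightarrow> nat \<Rightarrow> 'g set" where
  "product_power S n = {sum_list xs | xs. length xs = n \<and> set xs \<subseteq> S}"

section \<open>Measures\<close>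

definition atomless :: "'a measure \<Rightarrow> bool" where
  "atomless M \<longleftrightarrow>
     \<not> (\<exists>A\<in>sets M. emeasure M A > 0 \<and>
          (\<forall>B\<in>sets M. B \<subseteq> A \<longrightarrow> emeasure M B = 0 \<or> emeasure M B = emeasure M A))"

definition finite_regular_borel_measure :: "'g::topological_space measure \<Rightarrow> bool" where
  "finite_regular_borel_measure \<mu> \<longleftrightarrow>
     sets \<mu> = sets borel \<and> finite_measure \<mu> \<and>
     (\<forall>A\<in>sets borel. emeasure \<mu> A = (INF U\<in>{U. open U \<and> A \<subseteq> U}. emeasure \<mu> U)) \<and>
     (\<forall>A\<in>sets borel. emeasure \<mu> A = (SUP K\<in>{K. compact K \<and> K \<subseteq> A}. emeasure \<mu> K))"

text \<open>A Haar measure need not be sigma-finite, so inner regularity can only be required on open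
  sets.\<close>

definition left_haar_measure :: "'g::{topological_group_add,t2_space} measure \<Rightarrow> bool" where
  "left_haar_measure m \<longleftrightarrow>
     sets m = sets borel \<and>
     (\<forall>K. compact K \<longrightarrow> emeasure m K < \<infinity>) \<and>
     (\<forall>A\<in>sets borel. emeasure m A = (INF U\<in>{U. open U \<and> A \<subseteq> U}. emeasure m U)) \<and>
     (\<forall>V. open V \<longrightarrow> emeasure m V = (SUP K\<in>{K. compact K \<and> K \<subseteq> V}. emeasure m K)) \<and>
     (\<forall>g. \<forall>A\<in>sets borel. emeasure m ((+) g ` A) = emeasure m A) \<and>
     emeasure m UNIV \<noteq> 0"

end

theory Submission
  imports Defs
begin

text \<open>Write \<open>T\<close> and \<open>U\<close> for the operators \<open>\<pi>\<^sub>0(\<mu>)\<close> and \<open>\<lambda>\<^sub>G(\<mu>)\<close>. For a unit vector \<open>f\<close> in \<open>L\<^sup>2(G)\<close>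
  the numbers \<open>\<langle>(U\<^sup>* U)\<^sup>n f, f\<rangle>\<close> are log-convex in \<open>n\<close>, so they grow at least like
  \<open>\<parallel>U f\<parallel>\<close> to the power \<open>2n\<close>. On the other side \<open>\<langle>(T\<^sup>* T)\<^sup>n \<phi>, \<phi>\<rangle>\<close> is at most \<open>\<parallel>T\<parallel>\<close> to the power
  \<open>2n\<close> times \<open>\<parallel>\<phi>\<parallel>\<^sup>2\<close>. Both numbers are the same \<open>2n\<close>-fold positive integral over \<open>G\<close>, applied to
  the coefficient functions \<open>h \<mapsto> \<langle>\<lambda>\<^sub>G(h) f, f\<rangle>\<close> and \<open>h \<mapsto> \<langle>\<pi>\<^sub>0(h) \<phi>, \<phi>\<rangle>\<close>. If \<open>\<mu>\<close> lives on a compact set \<open>K\<close>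
  and \<open>S\<close> contains all \<open>k\<inverse> k'\<close> with \<open>k, k' \<in> K\<close>, only the values at \<open>h \<in> S\<^sup>n\<close> matter, and it is
  enough to dominate the first coefficient by the second there.

  The sets \<open>B\<^sub>n\<close> supply \<open>\<phi>\<close>. Let \<open>c\<^sub>n\<close> be the infimum of \<open>\<nu>(g B\<^sub>n \<inter> B\<^sub>n) / \<nu>(B\<^sub>n)\<close> over \<open>g \<in> F\<close>. Let \<open>A\<close> be a set of measure less than 1/2 that contains \<open>S\<^sup>n B\<^sub>n\<close>, and let
  \<open>\<phi>\<close> be the indicator of \<open>B\<^sub>n\<close> minus the multiple of the indicator of the complement of \<open>A\<close> that makes
  the integral zero. For \<open>h \<in> S\<^sup>n\<close> the two parts of \<open>\<phi>\<close> do not meet under translation by \<open>h\<close>, hence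
  \<open>\<langle>\<pi>\<^sub>0(h) \<phi>, \<phi>\<rangle> \<ge> \<nu>(h B\<^sub>n \<inter> B\<^sub>n)\<close>, which is nonnegative, and at least \<open>c\<^sub>n \<nu>(B\<^sub>n)\<close> if moreover \<open>h \<in> F\<close>
  (lemma \<open>displaced_vector\<close>). If the support of \<open>f\<close> is so small that its differences lie in \<open>F\<close>, then
  \<open>\<langle>\<lambda>\<^sub>G(h) f, f\<rangle>\<close> vanishes off \<open>F\<close>, and the domination holds up to the factor \<open>c\<^sub>n\<close>. A function of
  compact support is a finite sum of such pieces, which costs only a constant independent of \<open>n\<close>. So
  \<open>c\<^sub>n\<close> times the \<open>2n\<close>-th power of \<open>\<parallel>U f\<parallel>\<close> is at most a constant times the \<open>2n\<close>-th power of \<open>\<parallel>T\<parallel>\<close>,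
  and since the upper limit of the \<open>n\<close>-th roots of \<open>c\<^sub>n\<close> is at least 1, \<open>\<parallel>U f\<parallel> \<le> \<parallel>T\<parallel>\<close> follows
  (lemmas \<open>regular_form_bound\<close> and \<open>limsup_root_comparison\<close>). Functions of compact support are dense, and
  a general \<open>\<mu>\<close> is approximated in total mass by its restrictions to compact sets.

  Two points shape the details. The operators of the restricted measures, and all adjoints, have to be
  constructed; this is done with Riesz representation, hence with the completeness of \<open>L\<^sup>2\<close>. And no
  convolution powers of \<open>\<mu>\<close> occur: on a large group the multiplication need not be measurable for the
  product of the Borel sigma-algebras, so integrals are iterated, and each inner integral is again a
  coefficient function.\<close>

section \<open>Semi-inner product spaces\<close>

text \<open>Vectors of length zero are allowed, so that square-integrable functions themselves, rather than
  their classes, can serve as vectors. For the same reason the operations obey no laws of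
  their own: only their effect on the inner product is prescribed.\<close>

locale semi_inner_space =
  fixes V :: "'v set"
    and add :: "'v \<Rightarrow> 'v \<Rightarrow> 'v"
    and scale :: "complex \<Rightarrow> 'v \<Rightarrow> 'v"
    and ip :: "'v \<Rightarrow> 'v \<Rightarrow> complex"
  assumes nonempty: "V \<noteq> {}"
    and add_closed: "x \<in> V \<Longrightarrow> y \<in> V \<Longrightarrow> add x y \<in> V"
    and scale_closed: "x \<in> V \<Longrightarrow> scale c x \<in> V"
    and ip_add_left: "x \<in> V \<Longrightarrow> y \<in> V \<Longrightarrow> z \<in> V \<Longrightarrow> ip (add x y) z = ip x z + ip y z"
    and ip_scale_left: "x \<in> V \<Longrightarrow> z \<in> V \<Longrightarrow> ip (scale c x) z = c * ip x z"
    and ip_cnj: "x \<in> V \<Longrightarrow> y \<in> V \<Longrightarrow> cnj (ip x y) = ip y x"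
    and ip_nonneg: "x \<in> V \<Longrightarrow> 0 \<le> Re (ip x x)"
begin

definition diff :: "'v \<Rightarrow> 'v \<Rightarrow> 'v" where
  "diff x y = add x (scale (-1) y)"

definition nrm :: "'v \<Rightarrow> real" where
  "nrm x = sqrt (Re (ip x x))"

lemma diff_closed: "x \<in> V \<Longrightarrow> y \<in> V \<Longrightarrow> diff x y \<in> V"
  by (simp add: diff_def add_closed scale_closed)

lemma ip_add_right:
  assumes "x \<in> V" "y \<in> V" "z \<in> V"
  shows "ip z (add x y) = ip z x + ip z y"
proof -
  have "ip z (add x y) = cnj (ip (add x y) z)"
    using assms by (simp add: ip_cnj add_closed)
  then show ?thesis
    using assms by (simp add: ip_add_left ip_cnj)
qed

lemma ip_scale_right:
  assumes "x \<in> V" "z \<in> V"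
  shows "ip z (scale c x) = cnj c * ip z x"
proof -
  have "ip z (scale c x) = cnj (ip (scale c x) z)"
    using assms by (simp add: ip_cnj scale_closed)
  then show ?thesis
    using assms by (simp add: ip_scale_left ip_cnj)
qed

lemma ip_diff_left: "x \<in> V \<Longrightarrow> y \<in> V \<Longrightarrow> z \<in> V \<Longrightarrow> ip (diff x y) z = ip x z - ip y z"
  by (simp add: diff_def add_closed scale_closed ip_add_left ip_scale_left)

lemma ip_diff_right: "x \<in> V \<Longrightarrow> y \<in> V \<Longrightarrow> z \<in> V \<Longrightarrow> ip z (diff x y) = ip z x - ip z y"
  by (simp add: diff_def add_closed scale_closed ip_add_right ip_scale_right)

lemmas closed = add_closed scale_closed diff_closed

lemmas ip_expand = ip_add_left ip_add_right ip_scale_left ip_scale_right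
  ip_diff_left ip_diff_right

lemma nrm_nonneg: "x \<in> V \<Longrightarrow> 0 \<le> nrm x"
  by (simp add: nrm_def ip_nonneg)

lemma nrm_sq: "x \<in> V \<Longrightarrow> (nrm x)\<^sup>2 = Re (ip x x)"
  by (simp add: nrm_def ip_nonneg)

lemma ip_self: "x \<in> V \<Longrightarrow> ip x x = of_real ((nrm x)\<^sup>2)"
  using ip_cnj[of x x] by (simp add: nrm_sq complex_eq_iff)

lemma Re_ip_commute: "x \<in> V \<Longrightarrow> y \<in> V \<Longrightarrow> Re (ip y x) = Re (ip x y)"
  using ip_cnj[of x y, symmetric] by simp

lemma cauchy_schwarz:
  assumes x: "x \<in> V" and y: "y \<in> V"
  shows "cmod (ip x y) \<le> nrm x * nrm y"
proof -
  define s where "s = ip x y"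
  \<comment> \<open>The vector \<open>x - t \<langle>x, y\<rangle> y\<close> has nonnegative square length for every real \<open>t\<close>.\<close>
  have key: "2 * t * (cmod s)\<^sup>2 \<le> (nrm x)\<^sup>2 + t\<^sup>2 * (cmod s)\<^sup>2 * (nrm y)\<^sup>2" for t :: real
  proof -
    define c where "c = of_real t * s"
    have s': "ip y x = cnj s"
      using x y by (simp add: s_def ip_cnj)
    have "ip (diff x (scale c y)) (diff x (scale c y)) =
        ip x x - cnj c * s - c * cnj s + c * cnj c * ip y y"
      using x y by (simp add: ip_expand closed s' s_def algebra_simps)
    also have "\<dots> = of_real ((nrm x)\<^sup>2 - 2 * t * (cmod s)\<^sup>2 + t\<^sup>2 * (cmod s)\<^sup>2 * (nrm y)\<^sup>2)"
      using complex_norm_square[of s]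
      by (simp add: ip_self[OF x] ip_self[OF y] c_def power2_eq_square algebra_simps)
    finally have "Re (ip (diff x (scale c y)) (diff x (scale c y))) =
        (nrm x)\<^sup>2 - 2 * t * (cmod s)\<^sup>2 + t\<^sup>2 * (cmod s)\<^sup>2 * (nrm y)\<^sup>2"
      by simp
    with ip_nonneg[of "diff x (scale c y)"] x y show ?thesis
      by (simp add: closed)
  qed
  have "(cmod s)\<^sup>2 \<le> (nrm x * nrm y)\<^sup>2"
  proof (cases "nrm y = 0")
    \<comment> \<open>The inequality is then linear in \<open>t\<close>, and fails for large \<open>t\<close> unless \<open>s\<close> vanishes.\<close>
    case True
    have "(cmod s)\<^sup>2 = 0"
    proof (rule ccontr)
      assume "(cmod s)\<^sup>2 \<noteq> 0"
      with key[of "((nrm x)\<^sup>2 + 1) / (2 * (cmod s)\<^sup>2)"] True show False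
        by simp
    qed
    then show ?thesis
      by simp
  next
    case False
    define N where "N = (nrm y)\<^sup>2"
    have N: "0 < N"
      using False by (simp add: N_def)
    have "(1 / N)\<^sup>2 * (cmod s)\<^sup>2 * N = (cmod s)\<^sup>2 / N"
      using N by (simp add: power2_eq_square)
    then have "(cmod s)\<^sup>2 / N \<le> (nrm x)\<^sup>2"
      using key[of "1 / N"] by (simp add: N_def)
    then show ?thesis
      using N by (simp add: field_simps power_mult_distrib N_def)
  qed
  then show ?thesis
    using nrm_nonneg[OF x] nrm_nonneg[OF y] power2_le_imp_le[of "cmod s" "nrm x * nrm y"]
    by (simp add: s_def)
qed

lemma Re_ip_le: "x \<in> V \<Longrightarrow> y \<in> V \<Longrightarrow> Re (ip x y) \<le> nrm x * nrm y"
  using cauchy_schwarz complex_Re_le_cmod order_trans by blast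

lemma nrm_add_le:
  assumes "x \<in> V" "y \<in> V"
  shows "nrm (add x y) \<le> nrm x + nrm y"
proof (rule power2_le_imp_le)
  have "(nrm (add x y))\<^sup>2 = (nrm x)\<^sup>2 + 2 * Re (ip x y) + (nrm y)\<^sup>2"
    using assms by (simp add: nrm_sq closed ip_expand Re_ip_commute[of x y])
  then show "(nrm (add x y))\<^sup>2 \<le> (nrm x + nrm y)\<^sup>2"
    using Re_ip_le[OF assms] by (simp add: power2_sum)
qed (use assms in \<open>simp add: nrm_nonneg\<close>)

lemma nrm_scale: "x \<in> V \<Longrightarrow> nrm (scale c x) = cmod c * nrm x"
proof -
  assume x: "x \<in> V"
  have "ip (scale c x) (scale c x) = (c * cnj c) * ip x x"
    using x by (simp add: ip_expand closed)
  also have "\<dots> = of_real ((cmod c * nrm x)\<^sup>2)"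
    using x by (simp add: complex_norm_square[symmetric] ip_self power_mult_distrib)
  finally have "Re (ip (scale c x) (scale c x)) = (cmod c * nrm x)\<^sup>2"
    by (simp only: Re_complex_of_real)
  then show ?thesis
    using nrm_nonneg[OF x] by (simp add: nrm_def)
qed

lemma nrm_triangle:
  assumes "x \<in> V" "y \<in> V" "z \<in> V"
  shows "nrm (diff x z) \<le> nrm (diff x y) + nrm (diff y z)"
proof -
  have "ip (diff x z) (diff x z) = ip (add (diff x y) (diff y z)) (add (diff x y) (diff y z))"
    using assms by (simp add: ip_expand closed)
  then have "nrm (diff x z) = nrm (add (diff x y) (diff y z))"
    by (simp add: nrm_def)
  then show ?thesis
    using assms by (simp add: nrm_add_le closed)
qed

lemma nrm_diff_commute: "x \<in> V \<Longrightarrow> y \<in> V \<Longrightarrow> nrm (diff x y) = nrm (diff y x)"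
  by (simp add: nrm_def ip_expand closed)

text \<open>Test \<open>x\<close> against itself.\<close>

lemma nrm_le_if_ip_le:
  assumes x: "x \<in> V" and C: "0 \<le> C" and le: "\<And>y. y \<in> V \<Longrightarrow> cmod (ip x y) \<le> C * nrm y"
  shows "nrm x \<le> C"
proof (cases "nrm x = 0")
  case False
  have "(nrm x)\<^sup>2 \<le> C * nrm x"
    using le[OF x] x by (simp add: ip_self norm_power nrm_nonneg)
  then show ?thesis
    using False nrm_nonneg[OF x] by (simp add: power2_eq_square)
qed (use C in simp)

end

locale semi_hilbert_space = semi_inner_space +
  assumes complete: "\<And>X. (\<And>n. X n \<in> V) \<Longrightarrow>
    (\<And>e. 0 < e \<Longrightarrow> \<exists>N. \<forall>m\<ge>N. \<forall>n\<ge>N. nrm (diff (X m) (X n)) < e) \<Longrightarrow>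
    \<exists>x\<in>V. (\<lambda>n. nrm (diff (X n) x)) \<longlonglongrightarrow> 0"
begin

text \<open>The representing vector minimises \<open>J x = \<parallel>x\<parallel>\<^sup>2 - 2 Re (l x)\<close>. By the parallelogram law a
  minimising sequence is Cauchy, and at the limit the first variation of \<open>J\<close> vanishes.\<close>

lemma riesz_representation:
  assumes l_add: "\<And>x y. x \<in> V \<Longrightarrow> y \<in> V \<Longrightarrow> l (add x y) = l x + l y"
    and l_scale: "\<And>c x. x \<in> V \<Longrightarrow> l (scale c x) = cnj c * l x"
    and l_bound: "\<And>x. x \<in> V \<Longrightarrow> cmod (l x) \<le> C * nrm x"
  shows "\<exists>z\<in>V. \<forall>x\<in>V. ip z x = l x"
proof -
  define J where "J x = (nrm x)\<^sup>2 - 2 * Re (l x)" for x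
  have J_low: "- C\<^sup>2 \<le> J x" if "x \<in> V" for x
  proof -
    have "Re (l x) \<le> C * nrm x"
      using l_bound[OF that] complex_Re_le_cmod order_trans by blast
    moreover have "0 \<le> (nrm x - C)\<^sup>2"
      by simp
    ultimately show ?thesis
      by (simp add: J_def power2_eq_square algebra_simps)
  qed
  define d where "d = (INF x\<in>V. J x)"
  have bdd: "bdd_below (J ` V)"
    using J_low by (auto intro!: bdd_belowI)
  have d_le: "d \<le> J x" if "x \<in> V" for x
    unfolding d_def using bdd that by (rule cINF_lower)
  have "\<exists>x\<in>V. J x < d + 1 / real (Suc n)" for n
  proof -
    have "d < d + 1 / real (Suc n)"
      by simp
    then show ?thesis
      unfolding d_def using cINF_less_iff[OF nonempty bdd] by blast
  qed
  then obtain X where X: "\<And>n. X n \<in> V" and JX: "\<And>n. J (X n) < d + 1 / real (Suc n)"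
    by metis
  have J_pert: "J (add x w) = J x + (nrm w)\<^sup>2 + 2 * Re (ip x w - l w)"
    if "x \<in> V" "w \<in> V" for x w
    using that by (simp add: J_def nrm_sq ip_expand closed l_add Re_ip_commute[of x w])
  have par: "(nrm (diff x y))\<^sup>2 = 2 * J x + 2 * J y - 4 * J (scale (1/2) (add x y))"
    if "x \<in> V" "y \<in> V" for x y
    using that by (simp add: J_def nrm_sq ip_expand closed l_add l_scale Re_ip_commute[of x y]
        field_simps)
  have X_close: "(nrm (diff (X m) (X n)))\<^sup>2 \<le> 2 / real (Suc m) + 2 / real (Suc n)" for m n
    using par[OF X[of m] X[of n]] JX[of m] JX[of n] d_le[of "scale (1/2) (add (X m) (X n))"] X
    by (simp add: closed)
  have "\<exists>N. \<forall>m\<ge>N. \<forall>n\<ge>N. nrm (diff (X m) (X n)) < e" if "0 < e" for e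
  proof -
    have "0 < e\<^sup>2 / 4"
      using that by simp
    then obtain N where "inverse (real (Suc N)) < e\<^sup>2 / 4"
      using reals_Archimedean by blast
    then have N: "1 / real (Suc N) < e\<^sup>2 / 4"
      by (simp only: inverse_eq_divide)
    have "nrm (diff (X m) (X n)) < e" if mn: "m \<ge> N" "n \<ge> N" for m n
    proof (rule power2_less_imp_less)
      have "1 / real (Suc m) \<le> 1 / real (Suc N)" "1 / real (Suc n) \<le> 1 / real (Suc N)"
        using mn by (auto intro!: divide_left_mono)
      then show "(nrm (diff (X m) (X n)))\<^sup>2 < e\<^sup>2"
        using X_close[of m n] N by simp
    qed (use \<open>0 < e\<close> in simp)
    then show ?thesis
      by blast
  qed
  then obtain z where z: "z \<in> V" and lim: "(\<lambda>n. nrm (diff (X n) z)) \<longlonglongrightarrow> 0"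
    using complete[of X] X by blast
  have ip_lim: "(\<lambda>n. ip (X n) w) \<longlonglongrightarrow> ip z w" if w: "w \<in> V" for w
  proof (rule LIM_zero_cancel, rule Lim_null_comparison)
    show "\<forall>\<^sub>F n in sequentially. norm (ip (X n) w - ip z w) \<le> nrm (diff (X n) z) * nrm w"
      using cauchy_schwarz[OF diff_closed[OF X z] w] X z w
      by (simp add: ip_expand)
    show "(\<lambda>n. nrm (diff (X n) z) * nrm w) \<longlonglongrightarrow> 0"
      using tendsto_mult_left_zero[OF lim] by simp
  qed
  \<comment> \<open>Moving from \<open>X n\<close> along \<open>w\<close> cannot lower \<open>J\<close> by more than \<open>1 / (n + 1)\<close>; passing to the limit
      avoids the question of whether \<open>J\<close> is continuous.\<close>
  have quad: "0 \<le> t\<^sup>2 * (nrm w)\<^sup>2 + 2 * t * Re (ip z w - l w)" if w: "w \<in> V" for w and t :: real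
  proof (rule LIMSEQ_le_const)
    have "(\<lambda>n. 1 / real (Suc n)) \<longlonglongrightarrow> 0"
      by (rule LIMSEQ_Suc[OF lim_1_over_n])
    then have "(\<lambda>n. t\<^sup>2 * (nrm w)\<^sup>2 + 2 * t * Re (ip (X n) w - l w) + 1 / real (Suc n))
        \<longlonglongrightarrow> t\<^sup>2 * (nrm w)\<^sup>2 + 2 * t * Re (ip z w - l w) + 0"
      by (intro tendsto_add tendsto_mult tendsto_Re tendsto_diff tendsto_const ip_lim w)
    then show "(\<lambda>n. t\<^sup>2 * (nrm w)\<^sup>2 + 2 * t * Re (ip (X n) w - l w) + 1 / real (Suc n))
        \<longlonglongrightarrow> t\<^sup>2 * (nrm w)\<^sup>2 + 2 * t * Re (ip z w - l w)"
      by simp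
    have "0 \<le> t\<^sup>2 * (nrm w)\<^sup>2 + 2 * t * Re (ip (X n) w - l w) + 1 / real (Suc n)" for n
    proof -
      have "d \<le> J (add (X n) (scale (of_real t) w))"
        using X w by (intro d_le closed)
      also have "\<dots> = J (X n) + t\<^sup>2 * (nrm w)\<^sup>2 + 2 * t * Re (ip (X n) w - l w)"
        using X w
        by (simp add: J_pert closed nrm_scale power_mult_distrib ip_expand l_scale algebra_simps)
      finally show ?thesis
        using JX[of n] by simp
    qed
    then show "\<exists>N. \<forall>n\<ge>N.
        0 \<le> t\<^sup>2 * (nrm w)\<^sup>2 + 2 * t * Re (ip (X n) w - l w) + 1 / real (Suc n)"
      by blast
  qed
  have Re0: "Re (ip z w - l w) = 0" if w: "w \<in> V" for w
  proof (rule ccontr)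
    define r where "r = Re (ip z w - l w)"
    define N where "N = (nrm w)\<^sup>2 + 1"
    assume "Re (ip z w - l w) \<noteq> 0"
    then have r: "r \<noteq> 0"
      by (simp add: r_def)
    have N: "0 < N"
      by (simp add: N_def add_nonneg_pos)
    \<comment> \<open>The step \<open>- r / \<parallel>w\<parallel>\<^sup>2\<close> would minimise the quadratic; \<open>N\<close> keeps it defined when \<open>\<parallel>w\<parallel> = 0\<close>.\<close>
    have "0 \<le> (- r / N)\<^sup>2 * (nrm w)\<^sup>2 + 2 * (- r / N) * r"
      using quad[OF w, of "- r / N"] by (simp add: r_def)
    also have "\<dots> = (r / N)\<^sup>2 * ((nrm w)\<^sup>2 - 2 * N)"
      using N by (simp add: power2_eq_square field_simps)
    also have "\<dots> < 0"
    proof -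
      have "(nrm w)\<^sup>2 < N"
        by (simp add: N_def)
      then have "(nrm w)\<^sup>2 - 2 * N < 0"
        using N by linarith
      moreover have "0 < (r / N)\<^sup>2"
        using r N by simp
      ultimately show ?thesis
        by (rule mult_pos_neg[rotated])
    qed
    finally show False
      by simp
  qed
  have "ip z w = l w" if w: "w \<in> V" for w
    using Re0[OF w] Re0[OF scale_closed[OF w, of \<i>]] w z
    by (simp add: ip_expand l_scale complex_eq_iff)
  with z show ?thesis
    by blast
qed

end

section \<open>Averaging a unitary representation\<close>

text \<open>The representation enters through its coefficients only: linearity and unitarity of the
  operators \<open>\<pi> g\<close> hold up to vectors of length zero, and follow from \<open>rep_zero\<close> and \<open>rep_add\<close>.\<close>

locale unitary_average =
  semi_hilbert_space V add scale ip + finite_measure \<kappa>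
  for V :: "'v set"
    and add :: "'v \<Rightarrow> 'v \<Rightarrow> 'v"
    and scale :: "complex \<Rightarrow> 'v \<Rightarrow> 'v"
    and ip :: "'v \<Rightarrow> 'v \<Rightarrow> complex"
    and \<kappa> :: "'g::{group_add, topological_space} measure" +
  fixes \<pi> :: "'g \<Rightarrow> 'v \<Rightarrow> 'v"
  assumes sets_kappa: "sets \<kappa> = sets borel"
    and rep_closed: "x \<in> V \<Longrightarrow> \<pi> g x \<in> V"
    and rep_zero: "x \<in> V \<Longrightarrow> y \<in> V \<Longrightarrow> ip (\<pi> 0 x) y = ip x y"
    and rep_add: "x \<in> V \<Longrightarrow> y \<in> V \<Longrightarrow> ip (\<pi> (g + h) x) y = ip (\<pi> h x) (\<pi> (- g) y)"
    and coef_measurable: "x \<in> V \<Longrightarrow> y \<in> V \<Longrightarrow> (\<lambda>g. ip (\<pi> g x) y) \<in> borel_measurable borel"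
begin

lemma rep_adjoint:
  assumes "x \<in> V" "y \<in> V"
  shows "ip (\<pi> (- g) x) y = ip x (\<pi> g y)"
proof -
  have "ip (\<pi> (- g) x) y = ip (\<pi> 0 x) (\<pi> g y)"
    using rep_add[OF assms, of "- g" 0] by simp
  also have "\<dots> = ip x (\<pi> g y)"
    using assms by (simp add: rep_zero rep_closed)
  finally show ?thesis .
qed

lemma nrm_rep: "x \<in> V \<Longrightarrow> nrm (\<pi> g x) = nrm x"
  using rep_add[of x x "- g" g] by (simp add: nrm_def rep_zero)

lemma coef_bound: "x \<in> V \<Longrightarrow> y \<in> V \<Longrightarrow> cmod (ip (\<pi> g x) y) \<le> nrm x * nrm y"
  using cauchy_schwarz[of "\<pi> g x" y] by (simp add: nrm_rep rep_closed)

lemma integrable_coef: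
  assumes "x \<in> V" "y \<in> V"
  shows "integrable \<kappa> (\<lambda>g. ip (\<pi> g x) y)"
proof (rule integrable_const_bound)
  show "(\<lambda>g. ip (\<pi> g x) y) \<in> borel_measurable \<kappa>"
    using coef_measurable[OF assms] by (simp add: sets_kappa cong: measurable_cong_sets)
  show "AE g in \<kappa>. norm (ip (\<pi> g x) y) \<le> nrm x * nrm y"
    using coef_bound[OF assms] by simp
qed

lemma coef_uminus: "x \<in> V \<Longrightarrow> y \<in> V \<Longrightarrow> ip (\<pi> (- g) x) y = cnj (ip (\<pi> g y) x)"
  by (simp add: rep_adjoint ip_cnj rep_closed)

lemma integrable_coef_uminus:
  "x \<in> V \<Longrightarrow> y \<in> V \<Longrightarrow> integrable \<kappa> (\<lambda>g. ip (\<pi> (- g) x) y)"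
  by (simp add: coef_uminus integrable_coef)

lemma integrable_coef_shift:
  "x \<in> V \<Longrightarrow> y \<in> V \<Longrightarrow> integrable \<kappa> (\<lambda>g. ip (\<pi> (h + g) x) y)"
  by (simp add: rep_add integrable_coef rep_closed)

lemma integrable_coef_shift_uminus:
  "x \<in> V \<Longrightarrow> y \<in> V \<Longrightarrow> integrable \<kappa> (\<lambda>g. ip (\<pi> (h + - g) x) y)"
  by (simp only: rep_add integrable_coef_uminus rep_closed)

text \<open>The operator obtained by integrating the representation against \<open>\<kappa>\<close>, and its
  adjoint. They are determined up to vectors of length zero only, whence the choice.\<close>

definition avg :: "'v \<Rightarrow> 'v" where
  "avg x = (SOME z. z \<in> V \<and> (\<forall>y\<in>V. ip z y = (\<integral>g. ip (\<pi> g x) y \<partial>\<kappa>)))"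

definition avg_adj :: "'v \<Rightarrow> 'v" where
  "avg_adj x = (SOME z. z \<in> V \<and> (\<forall>y\<in>V. ip z y = (\<integral>g. ip (\<pi> (- g) x) y \<partial>\<kappa>)))"

lemma integral_rep_exists:
  assumes x: "x \<in> V" and p: "\<And>g. p g \<in> V" "\<And>g. nrm (p g) \<le> nrm x"
    and int: "\<And>y. y \<in> V \<Longrightarrow> integrable \<kappa> (\<lambda>g. ip (p g) y)"
  shows "\<exists>z\<in>V. \<forall>y\<in>V. ip z y = (\<integral>g. ip (p g) y \<partial>\<kappa>)"
proof (rule riesz_representation)
  show "cmod (\<integral>g. ip (p g) y \<partial>\<kappa>) \<le> (nrm x * measure \<kappa> (space \<kappa>)) * nrm y" if y: "y \<in> V" for y
  proof -
    have "cmod (\<integral>g. ip (p g) y \<partial>\<kappa>) \<le> (\<integral>g. cmod (ip (p g) y) \<partial>\<kappa>)"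
      by (rule integral_norm_bound)
    also have "\<dots> \<le> (\<integral>g. nrm x * nrm y \<partial>\<kappa>)"
    proof (rule integral_mono)
      show "cmod (ip (p g) y) \<le> nrm x * nrm y" for g
        using cauchy_schwarz[OF p(1) y, of g] mult_right_mono[OF p(2)[of g] nrm_nonneg[OF y]]
        by simp
    qed (use int[OF y] in auto)
    finally show ?thesis
      by (simp add: mult_ac)
  qed
qed (use p int in \<open>auto simp: ip_expand\<close>)

lemma avg:
  assumes x: "x \<in> V"
  shows avg_closed: "avg x \<in> V"
    and ip_avg: "y \<in> V \<Longrightarrow> ip (avg x) y = (\<integral>g. ip (\<pi> g x) y \<partial>\<kappa>)"
proof -
  have "\<exists>z. z \<in> V \<and> (\<forall>y\<in>V. ip z y = (\<integral>g. ip (\<pi> g x) y \<partial>\<kappa>))"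
    using integral_rep_exists[OF x, of "\<lambda>g. \<pi> g x"] x
    by (auto simp: rep_closed nrm_rep integrable_coef)
  from someI_ex[OF this] show "avg x \<in> V"
    and "y \<in> V \<Longrightarrow> ip (avg x) y = (\<integral>g. ip (\<pi> g x) y \<partial>\<kappa>)"
    unfolding avg_def by auto
qed

lemma avg_adj:
  assumes x: "x \<in> V"
  shows avg_adj_closed: "avg_adj x \<in> V"
    and ip_avg_adj: "y \<in> V \<Longrightarrow> ip (avg_adj x) y = (\<integral>g. ip (\<pi> (- g) x) y \<partial>\<kappa>)"
proof -
  have "\<exists>z. z \<in> V \<and> (\<forall>y\<in>V. ip z y = (\<integral>g. ip (\<pi> (- g) x) y \<partial>\<kappa>))"
    using integral_rep_exists[OF x, of "\<lambda>g. \<pi> (- g) x"] x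
    by (auto simp: rep_closed nrm_rep integrable_coef_uminus)
  from someI_ex[OF this] show "avg_adj x \<in> V"
    and "y \<in> V \<Longrightarrow> ip (avg_adj x) y = (\<integral>g. ip (\<pi> (- g) x) y \<partial>\<kappa>)"
    unfolding avg_adj_def by auto
qed

lemma ip_avg_swap:
  assumes x: "x \<in> V" and y: "y \<in> V"
  shows "ip (avg x) y = ip x (avg_adj y)"
proof -
  have "ip x (avg_adj y) = cnj (\<integral>g. ip (\<pi> (- g) y) x \<partial>\<kappa>)"
    using x y by (simp add: ip_avg_adj[symmetric] ip_cnj avg_adj_closed)
  also have "\<dots> = (\<integral>g. cnj (ip (\<pi> (- g) y) x) \<partial>\<kappa>)"
    by (rule Bochner_Integration.integral_cnj[symmetric])
  also have "\<dots> = (\<integral>g. ip (\<pi> g x) y \<partial>\<kappa>)"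
    using x y by (simp add: coef_uminus)
  finally show ?thesis
    using x y by (simp add: ip_avg)
qed

lemma ip_avg_adj_swap:
  assumes "x \<in> V" "y \<in> V"
  shows "ip (avg_adj x) y = ip x (avg y)"
  using ip_avg_swap[OF assms(2,1)] ip_cnj assms avg_closed avg_adj_closed by metis

text \<open>An average is known through its inner products only, so a translation of it is first moved to
  the other argument.\<close>

lemma coef_avg:
  assumes x: "x \<in> V" and y: "y \<in> V"
  shows "ip (\<pi> h (avg x)) y = (\<integral>g. ip (\<pi> (h + g) x) y \<partial>\<kappa>)"
proof -
  have "ip (\<pi> h (avg x)) y = ip (avg x) (\<pi> (- h) y)"
    using rep_adjoint[OF avg_closed[OF x] y, of "- h"] by simp
  then show ?thesis
    using x y by (simp add: ip_avg rep_closed rep_add)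
qed

lemma coef_avg_adj:
  assumes x: "x \<in> V" and y: "y \<in> V"
  shows "ip (\<pi> h (avg_adj x)) y = (\<integral>g. ip (\<pi> (h + - g) x) y \<partial>\<kappa>)"
proof -
  have "ip (\<pi> h (avg_adj x)) y = ip (avg_adj x) (\<pi> (- h) y)"
    using rep_adjoint[OF avg_adj_closed[OF x] y, of "- h"] by simp
  then show ?thesis
    using x y by (simp only: ip_avg_adj rep_closed rep_add)
qed

text \<open>With \<open>A\<close> the averaging operator these are the vectors \<open>x\<close>, \<open>A x\<close>, \<open>A\<^sup>* A x\<close>, \<open>A A\<^sup>* A x\<close> and so on.
  They interpolate the powers of \<open>A\<^sup>* A\<close> in such a way that the square length of the \<open>n\<close>-th vector is
  \<open>\<langle>(A\<^sup>* A)\<^sup>n x, x\<rangle>\<close>, for odd \<open>n\<close> as well.\<close>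

fun alt :: "nat \<Rightarrow> 'v \<Rightarrow> 'v" where
  "alt 0 x = x"
| "alt (Suc n) x = (if even n then avg (alt n x) else avg_adj (alt n x))"

lemma alt_closed: "x \<in> V \<Longrightarrow> alt n x \<in> V"
  by (induction n) (auto simp: avg_closed avg_adj_closed)

text \<open>The parity condition makes the operator applied on the left the adjoint of the one applied on
  the right.\<close>

lemma ip_alt_move:
  assumes "x \<in> V" "y \<in> V" "odd (m + n)"
  shows "ip (alt (Suc m) x) (alt n y) = ip (alt m x) (alt (Suc n) y)"
  using assms by (auto simp: ip_avg_swap ip_avg_adj_swap alt_closed)

lemma ip_alt_double:
  assumes "x \<in> V" "y \<in> V"
  shows "ip (alt (2 * n) x) y = ip (alt n x) (alt n y)"
proof -
  have "ip (alt (n + k) x) (alt (n - k) y) = ip (alt n x) (alt n y)" if "k \<le> n" for k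
    using that
  proof (induction k)
    case (Suc k)
    have "ip (alt (n + Suc k) x) (alt (n - Suc k) y) = ip (alt (n + k) x) (alt (Suc (n - Suc k)) y)"
      using ip_alt_move[OF assms, of "n + k" "n - Suc k"] Suc.prems by simp
    also have "Suc (n - Suc k) = n - k"
      using Suc.prems by simp
    finally show ?case
      using Suc by simp
  qed simp
  from this[of n] show ?thesis
    by (simp add: mult_2)
qed

lemma nrm_alt_sq: "x \<in> V \<Longrightarrow> (nrm (alt n x))\<^sup>2 = Re (ip (alt (2 * n) x) x)"
  by (simp add: ip_alt_double nrm_sq alt_closed)

text \<open>Since averages are chosen up to vectors of length zero, \<open>alt\<close> is not additive on the nose; but
  \<open>\<langle>alt (2 n) z, x\<rangle>\<close> is additive in \<open>x\<close>, which yields the triangle inequality.\<close>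

lemma nrm_alt_add_le:
  assumes x: "x \<in> V" and y: "y \<in> V"
  shows "nrm (alt n (add x y)) \<le> nrm (alt n x) + nrm (alt n y)"
proof -
  define z where "z = add x y"
  have z: "z \<in> V"
    using x y by (simp add: z_def closed)
  have "(nrm (alt n z))\<^sup>2 = Re (ip (alt (2 * n) z) z)"
    using z by (rule nrm_alt_sq)
  also have "\<dots> = Re (ip (alt (2 * n) z) x) + Re (ip (alt (2 * n) z) y)"
    using x y z alt_closed[OF z] by (simp add: z_def ip_add_right)
  also have "\<dots> = Re (ip (alt n z) (alt n x)) + Re (ip (alt n z) (alt n y))"
    using x y z by (simp add: ip_alt_double)
  also have "\<dots> \<le> nrm (alt n z) * (nrm (alt n x) + nrm (alt n y))"
    using Re_ip_le[OF alt_closed alt_closed, OF z x, of n n] 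
      Re_ip_le[OF alt_closed alt_closed, OF z y, of n n]
    by (simp add: algebra_simps)
  finally show ?thesis
    using nrm_nonneg[OF alt_closed[OF x], of n] nrm_nonneg[OF alt_closed[OF y], of n]
      nrm_nonneg[OF alt_closed[OF z], of n]
    by (cases "nrm (alt n z) = 0") (auto simp: power2_eq_square z_def)
qed

text \<open>Moving one operator across the inner product turns the square of a length into the inner product
  of its two neighbours; Cauchy--Schwarz does the rest.\<close>

lemma nrm_alt_log_convex:
  assumes x: "x \<in> V"
  shows "(nrm (alt (Suc n) x))\<^sup>2 \<le> nrm (alt (Suc (Suc n)) x) * nrm (alt n x)"
proof -
  have "(nrm (alt (Suc n) x))\<^sup>2 = Re (ip (alt (Suc (Suc n)) x) (alt n x))"
    using ip_alt_move[OF x x, of "Suc n" n] x by (simp add: nrm_sq alt_closed del: alt.simps)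
  also have "\<dots> \<le> nrm (alt (Suc (Suc n)) x) * nrm (alt n x)"
    by (intro Re_ip_le alt_closed x)
  finally show ?thesis .
qed

text \<open>By log-convexity the ratio of consecutive lengths never decreases, so the lengths grow at
  least as fast as the first ratio predicts.\<close>

lemma nrm_alt_growth:
  assumes x: "x \<in> V"
  shows "(nrm (avg x)) ^ n * nrm x \<le> nrm (alt n x) * (nrm x) ^ n"
proof -
  define d where "d n = nrm (alt n x)" for n
  have d0: "0 \<le> d n" for n
    using x by (simp add: d_def nrm_nonneg alt_closed)
  have cvx: "(d (Suc n))\<^sup>2 \<le> d (Suc (Suc n)) * d n" for n
    unfolding d_def by (rule nrm_alt_log_convex[OF x])
  have ratio: "d 1 * d n \<le> d 0 * d (Suc n)" for n
  proof (induction n)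
    case (Suc n)
    show ?case
    proof (cases "d n = 0")
      case True
      then show ?thesis
        using cvx[of n] d0 by simp
    next
      case False
      have "(d 1 * d (Suc n)) * d n \<le> d 0 * (d (Suc n))\<^sup>2"
        using mult_right_mono[OF Suc d0[of "Suc n"]] by (simp add: power2_eq_square mult_ac)
      also have "\<dots> \<le> (d 0 * d (Suc (Suc n))) * d n"
        using mult_left_mono[OF cvx[of n] d0[of 0]] by (simp add: mult_ac)
      finally show ?thesis
        using False d0[of n] by simp
    qed
  qed simp
  have "(d 1) ^ n * d 0 \<le> d n * (d 0) ^ n"
  proof (induction n)
    case (Suc n)
    have "(d 1) ^ Suc n * d 0 \<le> (d 1 * d n) * (d 0) ^ n"
      using mult_left_mono[OF Suc d0[of 1]] by (simp add: mult_ac)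
    also have "\<dots> \<le> (d 0 * d (Suc n)) * (d 0) ^ n"
      using ratio d0[of 0] by (intro mult_right_mono) auto
    finally show ?case
      by (simp add: mult_ac)
  qed simp
  then show ?thesis
    by (simp add: d_def)
qed

lemma nrm_alt_le:
  assumes C: "0 \<le> C"
    and bound: "\<And>x y. x \<in> V \<Longrightarrow> y \<in> V \<Longrightarrow> cmod (\<integral>g. ip (\<pi> g x) y \<partial>\<kappa>) \<le> C * nrm x * nrm y"
    and x: "x \<in> V"
  shows "nrm (alt n x) \<le> C ^ n * nrm x"
proof (induction n)
  case (Suc n)
  define z where "z = alt n x"
  have z: "z \<in> V"
    using x by (simp add: z_def alt_closed)
  have "nrm (avg z) \<le> C * nrm z"
    using bound z C by (intro nrm_le_if_ip_le) (auto simp: avg_closed ip_avg nrm_nonneg)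
  moreover have "nrm (avg_adj z) \<le> C * nrm z"
  proof (intro nrm_le_if_ip_le)
    show "cmod (ip (avg_adj z) y) \<le> C * nrm z * nrm y" if y: "y \<in> V" for y
    proof -
      have "cmod (ip (avg_adj z) y) = cmod (ip (avg y) z)"
        using y z ip_cnj[of "avg y" z] complex_mod_cnj[of "ip (avg y) z"]
        by (simp add: ip_avg_adj_swap avg_closed)
      then show ?thesis
        using bound[OF y z] y z by (simp add: ip_avg mult_ac)
    qed
  qed (use z C in \<open>auto simp: avg_adj_closed nrm_nonneg\<close>)
  ultimately have "nrm (alt (Suc n) x) \<le> C * nrm z"
    by (simp add: z_def)
  also have "\<dots> \<le> C * (C ^ n * nrm x)"
    using Suc C by (intro mult_left_mono) (auto simp: z_def)
  finally show ?case
    by (simp add: mult_ac)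
qed simp

end

section \<open>Comparing two representations\<close>

lemma product_power_0: "product_power S 0 = {0}"
  by (auto simp: product_power_def)

lemma product_power_SucI:
  assumes "h \<in> product_power S n" "s \<in> S"
  shows "h + s \<in> product_power S (Suc n)"
proof -
  obtain xs where xs: "h = sum_list xs" "length xs = n" "set xs \<subseteq> S"
    using assms(1) by (auto simp: product_power_def)
  then show ?thesis
    unfolding product_power_def using assms(2)
    by (intro CollectI exI[of _ "xs @ [s]"]) auto
qed

locale average_pair =
  L: unitary_average V add scale ip \<kappa> \<pi> + R: unitary_average W add' scale' ip' \<kappa> \<rho>
  for V :: "'v set" and add scale ip
    and W :: "'w set" and add' scale' ip'
    and \<kappa> :: "'g::{group_add, topological_space} measure" and \<pi> \<rho>
begin

text \<open>The coefficient of \<open>A\<^sup>* A x\<close> at \<open>h\<close> is the double integral of the coefficient of \<open>x\<close> at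
  \<open>h - g + g'\<close>, where \<open>g\<close> and \<open>g'\<close> may be taken in \<open>K\<close>. An inequality between coefficients of the two
  representations on \<open>n + 1\<close> factors from \<open>S\<close> is thereby inherited on \<open>n\<close> factors.\<close>

lemma domination_step:
  assumes K: "AE g in \<kappa>. g \<in> K" and S: "\<And>g g'. g \<in> K \<Longrightarrow> g' \<in> K \<Longrightarrow> - g + g' \<in> S"
    and x: "x \<in> V" "y \<in> V" and x': "x' \<in> W" "y' \<in> W"
    and dom: "\<And>h. h \<in> product_power S (Suc n) \<Longrightarrow>
      \<alpha> * Re (ip (\<pi> h x) y) \<le> \<beta> * Re (ip' (\<rho> h x') y')"
    and h: "h \<in> product_power S n"
  shows "\<alpha> * Re (ip (\<pi> h (L.avg_adj (L.avg x))) y)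
    \<le> \<beta> * Re (ip' (\<rho> h (R.avg_adj (R.avg x'))) y')"
proof -
  have inner: "\<alpha> * Re (ip (\<pi> (h + - g) (L.avg x)) y) \<le> \<beta> * Re (ip' (\<rho> (h + - g) (R.avg x')) y')"
    if g: "g \<in> K" for g
  proof -
    have "\<alpha> * Re (ip (\<pi> (h + - g) (L.avg x)) y) = (\<integral>g'. \<alpha> * Re (ip (\<pi> (h + - g + g') x) y) \<partial>\<kappa>)"
      using x by (simp add: L.coef_avg integral_Re L.integrable_coef_shift del: add_uminus_conv_diff)
    also have "\<dots> \<le> (\<integral>g'. \<beta> * Re (ip' (\<rho> (h + - g + g') x') y') \<partial>\<kappa>)"
    proof (rule integral_mono_AE)
      show "AE g' in \<kappa>. \<alpha> * Re (ip (\<pi> (h + - g + g') x) y) \<le> \<beta> * Re (ip' (\<rho> (h + - g + g') x') y')"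
        using K
      proof eventually_elim
        case (elim g')
        have "h + - g + g' \<in> product_power S (Suc n)"
          using product_power_SucI[OF h S[OF g elim]] by (simp only: add.assoc)
        then show ?case
          by (rule dom)
      qed
    qed (use x x' in \<open>auto simp: L.integrable_coef_shift R.integrable_coef_shift
        simp del: add_uminus_conv_diff intro!: integrable_Re\<close>)
    also have "\<dots> = \<beta> * Re (ip' (\<rho> (h + - g) (R.avg x')) y')"
      using x' by (simp add: R.coef_avg integral_Re R.integrable_coef_shift del: add_uminus_conv_diff)
    finally show ?thesis .
  qed
  have "\<alpha> * Re (ip (\<pi> h (L.avg_adj (L.avg x))) y)
      = (\<integral>g. \<alpha> * Re (ip (\<pi> (h + - g) (L.avg x)) y) \<partial>\<kappa>)"
    using x by (simp add: L.coef_avg_adj L.avg_closed integral_Re L.integrable_coef_shift_uminus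
        del: add_uminus_conv_diff)
  also have "\<dots> \<le> (\<integral>g. \<beta> * Re (ip' (\<rho> (h + - g) (R.avg x')) y') \<partial>\<kappa>)"
  proof (rule integral_mono_AE)
    show "AE g in \<kappa>. \<alpha> * Re (ip (\<pi> (h + - g) (L.avg x)) y) \<le> \<beta> * Re (ip' (\<rho> (h + - g) (R.avg x')) y')"
      using K by eventually_elim (rule inner)
  qed (use x x' in \<open>auto simp: L.integrable_coef_shift_uminus R.integrable_coef_shift_uminus
      L.avg_closed R.avg_closed simp del: add_uminus_conv_diff intro!: integrable_Re\<close>)
  also have "\<dots> = \<beta> * Re (ip' (\<rho> h (R.avg_adj (R.avg x'))) y')"
    using x' by (simp add: R.coef_avg_adj R.avg_closed integral_Re R.integrable_coef_shift_uminus
        del: add_uminus_conv_diff)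
  finally show ?thesis .
qed

text \<open>After \<open>n\<close> steps only the value at the identity remains, where the coefficient of \<open>(A\<^sup>* A)\<^sup>n x\<close>
  is the square length of \<open>alt n x\<close>.\<close>

lemma domination:
  assumes K: "AE g in \<kappa>. g \<in> K" and S: "\<And>g g'. g \<in> K \<Longrightarrow> g' \<in> K \<Longrightarrow> - g + g' \<in> S"
    and x: "x \<in> V" and x': "x' \<in> W"
    and dom: "\<And>h. h \<in> product_power S n \<Longrightarrow>
      \<alpha> * Re (ip (\<pi> h x) x) \<le> \<beta> * Re (ip' (\<rho> h x') x')"
  shows "\<alpha> * (L.nrm (L.alt n x))\<^sup>2 \<le> \<beta> * (R.nrm (R.alt n x'))\<^sup>2"
proof -
  have "\<alpha> * Re (ip (\<pi> h (L.alt (2 * j) x)) x) \<le> \<beta> * Re (ip' (\<rho> h (R.alt (2 * j) x')) x')"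
    if "j \<le> n" "h \<in> product_power S (n - j)" for j h
    using that
  proof (induction j arbitrary: h)
    case (Suc j)
    have "Suc (n - Suc j) = n - j"
      using Suc.prems by simp
    then show ?case
      using domination_step[OF K S L.alt_closed[OF x] x R.alt_closed[OF x'] x',
          of "n - Suc j" \<alpha> "2 * j" \<beta> "2 * j" h] Suc
      by simp
  qed (use dom in simp)
  from this[of n 0] show ?thesis
    using x x' by (simp add: product_power_0 L.nrm_alt_sq R.nrm_alt_sq L.rep_zero R.rep_zero
        L.alt_closed R.alt_closed)
qed

end

section \<open>Square-integrable functions\<close>

definition padd :: "('a \<Rightarrow> complex) \<Rightarrow> ('a \<Rightarrow> complex) \<Rightarrow> 'a \<Rightarrow> complex" where
  "padd f g = (\<lambda>x. f x + g x)"

definition pscale :: "complex \<Rightarrow> ('a \<Rightarrow> complex) \<Rightarrow> 'a \<Rightarrow> complex" where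
  "pscale c f = (\<lambda>x. c * f x)"

definition l2ip :: "'a measure \<Rightarrow> ('a \<Rightarrow> complex) \<Rightarrow> ('a \<Rightarrow> complex) \<Rightarrow> complex" where
  "l2ip M f g = (\<integral>x. f x * cnj (g x) \<partial>M)"

lemma borel_measurable_cnj [measurable (raw)]:
  "f \<in> borel_measurable M \<Longrightarrow> (\<lambda>x. cnj (f x)) \<in> borel_measurable M"
  by (rule borel_measurable_continuous_on[of cnj]) (auto intro: continuous_intros)

lemma sq_integrableI:
  "f \<in> borel_measurable M \<Longrightarrow> integrable M (\<lambda>x. (cmod (f x))\<^sup>2) \<Longrightarrow> f \<in> sq_integrable M"
  by (simp add: sq_integrable_def)

lemma sq_integrableD:
  assumes "f \<in> sq_integrable M"
  shows "f \<in> borel_measurable M" "integrable M (\<lambda>x. (cmod (f x))\<^sup>2)"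
  using assms by (simp_all add: sq_integrable_def)

lemma sq_integrable_bound:
  assumes "g \<in> sq_integrable M" "f \<in> borel_measurable M" 
    and "\<And>x. x \<in> space M \<Longrightarrow> cmod (f x) \<le> cmod (g x)"
  shows "f \<in> sq_integrable M"
proof (rule sq_integrableI)
  have [measurable]: "f \<in> borel_measurable M"
    by fact
  show "integrable M (\<lambda>x. (cmod (f x))\<^sup>2)"
    by (rule Bochner_Integration.integrable_bound[OF sq_integrableD(2)[OF assms(1)]])
       (auto intro!: AE_I2 power_mono assms(3))
qed fact

lemma integrable_mult_cnj:
  assumes f: "f \<in> sq_integrable M" and g: "g \<in> sq_integrable M"
  shows "integrable M (\<lambda>x. f x * cnj (g x))"
proof (rule Bochner_Integration.integrable_bound)
  note [measurable] = sq_integrableD(1)[OF f] sq_integrableD(1)[OF g]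
  show "integrable M (\<lambda>x. (cmod (f x))\<^sup>2 + (cmod (g x))\<^sup>2)"
    using f g by (auto dest: sq_integrableD)
  show "(\<lambda>x. f x * cnj (g x)) \<in> borel_measurable M"
    by measurable
  show "AE x in M. norm (f x * cnj (g x)) \<le> norm ((cmod (f x))\<^sup>2 + (cmod (g x))\<^sup>2)"
  proof (rule AE_I2)
    fix x
    have "cmod (f x) * cmod (g x) \<le> (cmod (f x))\<^sup>2 + (cmod (g x))\<^sup>2"
      using sum_squares_bound[of "cmod (f x)" "cmod (g x)"]
        mult_nonneg_nonneg[OF norm_ge_zero norm_ge_zero, of "f x" "g x"] by linarith
    then show "norm (f x * cnj (g x)) \<le> norm ((cmod (f x))\<^sup>2 + (cmod (g x))\<^sup>2)"
      by (simp add: norm_mult)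
  qed
qed

lemma sq_integrable_padd:
  assumes f: "f \<in> sq_integrable M" and g: "g \<in> sq_integrable M"
  shows "padd f g \<in> sq_integrable M"
proof (rule sq_integrableI)
  note [measurable] = sq_integrableD(1)[OF f] sq_integrableD(1)[OF g]
  show "padd f g \<in> borel_measurable M"
    unfolding padd_def by measurable
  show "integrable M (\<lambda>x. (cmod (padd f g x))\<^sup>2)"
  proof (rule Bochner_Integration.integrable_bound)
    show "integrable M (\<lambda>x. 2 * (cmod (f x))\<^sup>2 + 2 * (cmod (g x))\<^sup>2)"
      using sq_integrableD(2)[OF f] sq_integrableD(2)[OF g] by simp
    show "(\<lambda>x. (cmod (padd f g x))\<^sup>2) \<in> borel_measurable M"
      unfolding padd_def by measurable
    show "AE x in M. norm ((cmod (padd f g x))\<^sup>2) \<le> norm (2 * (cmod (f x))\<^sup>2 + 2 * (cmod (g x))\<^sup>2)"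
    proof (rule AE_I2)
      fix x
      have "(cmod (f x + g x))\<^sup>2 \<le> (cmod (f x) + cmod (g x))\<^sup>2"
        by (intro power_mono norm_triangle_ineq) simp
      also have "\<dots> \<le> 2 * (cmod (f x))\<^sup>2 + 2 * (cmod (g x))\<^sup>2"
        using sum_squares_bound[of "cmod (f x)" "cmod (g x)"] by (simp add: power2_sum)
      finally show "norm ((cmod (padd f g x))\<^sup>2) \<le> norm (2 * (cmod (f x))\<^sup>2 + 2 * (cmod (g x))\<^sup>2)"
        by (simp add: padd_def)
    qed
  qed
qed

lemma sq_integrable_pscale:
  assumes f: "f \<in> sq_integrable M"
  shows "pscale c f \<in> sq_integrable M"
proof (rule sq_integrableI)
  note [measurable] = sq_integrableD(1)[OF f]
  show "pscale c f \<in> borel_measurable M"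
    unfolding pscale_def by measurable
  show "integrable M (\<lambda>x. (cmod (pscale c f x))\<^sup>2)"
    using f by (auto simp: pscale_def norm_mult power_mult_distrib dest: sq_integrableD)
qed

lemma l2ip_self: "l2ip M f f = of_real (\<integral>x. (cmod (f x))\<^sup>2 \<partial>M)"
  unfolding l2ip_def 
  by (subst integral_complex_of_real[symmetric]) (simp only: complex_norm_square)

lemma sq_integrable_const_zero: "(\<lambda>x. 0) \<in> sq_integrable M"
  by (simp add: sq_integrable_def)

interpretation l2: semi_inner_space "sq_integrable M" padd pscale "l2ip M" for M
proof
  show "sq_integrable M \<noteq> {}"
    using sq_integrable_const_zero by blast
  show "padd f g \<in> sq_integrable M" if "f \<in> sq_integrable M" "g \<in> sq_integrable M" for f g
    using that by (rule sq_integrable_padd)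
  show "pscale c f \<in> sq_integrable M" if "f \<in> sq_integrable M" for c f
    using that by (rule sq_integrable_pscale)
  show "l2ip M (padd f g) h = l2ip M f h + l2ip M g h"
    if "f \<in> sq_integrable M" "g \<in> sq_integrable M" "h \<in> sq_integrable M" for f g h
    using that by (simp add: l2ip_def padd_def distrib_right integrable_mult_cnj)
  show "l2ip M (pscale c f) h = c * l2ip M f h"
    if "f \<in> sq_integrable M" "h \<in> sq_integrable M" for c f h
    by (simp add: l2ip_def pscale_def mult.assoc)
  show "cnj (l2ip M f g) = l2ip M g f"
    if "f \<in> sq_integrable M" "g \<in> sq_integrable M" for f g
    by (simp add: l2ip_def Bochner_Integration.integral_cnj[symmetric] mult.commute)
  show "0 \<le> Re (l2ip M f f)" if "f \<in> sq_integrable M" for f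
    by (simp add: l2ip_self)
qed

abbreviation l2nrm :: "'a measure \<Rightarrow> ('a \<Rightarrow> complex) \<Rightarrow> real" where
  "l2nrm M \<equiv> semi_inner_space.nrm (l2ip M)"

abbreviation pdiff :: "('a \<Rightarrow> complex) \<Rightarrow> ('a \<Rightarrow> complex) \<Rightarrow> 'a \<Rightarrow> complex" where
  "pdiff \<equiv> semi_inner_space.diff padd pscale"

lemma pdiff_apply: "pdiff f g = (\<lambda>x. f x - g x)"
  using l2.diff_def by (auto simp: padd_def pscale_def)

lemma l2nrm_sq: "(l2nrm M f)\<^sup>2 = (\<integral>x. (cmod (f x))\<^sup>2 \<partial>M)"
  by (simp add: l2.nrm_def l2ip_self)

lemma l2nrm_nonneg: "0 \<le> l2nrm M f"
  by (simp add: l2.nrm_def l2ip_self)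

lemma nn_integral_sq:
  "f \<in> sq_integrable M \<Longrightarrow> (\<integral>\<^sup>+x. ennreal ((cmod (f x))\<^sup>2) \<partial>M) = ennreal ((l2nrm M f)\<^sup>2)"
  by (simp add: l2nrm_sq nn_integral_eq_integral sq_integrableD)

text \<open>A subsequence whose \<open>k\<close>-th step \<open>u k\<close> is at most \<open>1 / s\<close> in length, where \<open>s = 2 ^ k\<close>, converges
  almost everywhere: the functions \<open>s \<bar>u k\<bar>\<^sup>2\<close> have integrals at most \<open>1 / s\<close>, so their sum is finite
  almost everywhere, and \<open>\<bar>u k\<bar> \<le> 1 / s + s \<bar>u k\<bar>\<^sup>2\<close>. Fatou's lemma bounds the distance to the limit.\<close>

lemma riesz_fischer:
  fixes X :: "nat \<Rightarrow> 'a \<Rightarrow> complex"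
  assumes X: "\<And>n. X n \<in> sq_integrable M"
    and Cauchy: "\<And>e. 0 < e \<Longrightarrow> \<exists>N. \<forall>m\<ge>N. \<forall>n\<ge>N. l2nrm M (pdiff (X m) (X n)) < e"
  shows "\<exists>f\<in>sq_integrable M. (\<lambda>n. l2nrm M (pdiff (X n) f)) \<longlonglongrightarrow> 0"
proof -
  have [measurable]: "X n \<in> borel_measurable M" for n
    using X by (rule sq_integrableD)
  have "\<forall>k. \<exists>N. \<forall>m\<ge>N. \<forall>n\<ge>N. l2nrm M (pdiff (X m) (X n)) < (1/2) ^ k"
    using Cauchy by simp
  then obtain N where N: "\<And>k m n. m \<ge> N k \<Longrightarrow> n \<ge> N k \<Longrightarrow> l2nrm M (pdiff (X m) (X n)) < (1/2) ^ k"
    by metis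
  \<comment> \<open>The sum makes \<open>r\<close> increase past every bound \<open>N k\<close>, and the summand \<open>k\<close> makes it tend to
      infinity.\<close>
  define r where "r k = k + (\<Sum>i\<le>k. N i)" for k
  have rN: "N k \<le> r k" "N k \<le> r (Suc k)" for k
    using sum_nonneg[of "{..<k}" N] by (simp_all add: r_def lessThan_Suc_atMost[symmetric])
  define u where "u k = pdiff (X (r (Suc k))) (X (r k))" for k
  have u: "u k \<in> sq_integrable M" for k
    using X by (simp add: u_def l2.diff_closed)
  have [measurable]: "u k \<in> borel_measurable M" for k
    using u by (rule sq_integrableD)
  have step: "(\<integral>\<^sup>+x. ennreal (2 ^ k * (cmod (u k x))\<^sup>2) \<partial>M) \<le> ennreal ((1/2) ^ k)" for k
  proof -
    have "l2nrm M (u k) \<le> (1/2) ^ k"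
      unfolding u_def using N[of k] rN by (intro less_imp_le) auto
    then have "(l2nrm M (u k))\<^sup>2 \<le> ((1/2) ^ k)\<^sup>2"
      by (intro power_mono l2nrm_nonneg)
    then have "2 ^ k * (l2nrm M (u k))\<^sup>2 \<le> 2 ^ k * ((1/2) ^ k)\<^sup>2"
      by (intro mult_left_mono) auto
    also have "\<dots> = (1/2) ^ k"
      by (simp add: power2_eq_square power_mult_distrib[symmetric] mult.assoc[symmetric])
    finally have "2 ^ k * (l2nrm M (u k))\<^sup>2 \<le> (1/2) ^ k" .
    moreover have "(\<integral>\<^sup>+x. ennreal (2 ^ k * (cmod (u k x))\<^sup>2) \<partial>M) = ennreal (2 ^ k * (l2nrm M (u k))\<^sup>2)"
      by (subst ennreal_mult) 
         (auto simp: ennreal_mult nn_integral_cmult nn_integral_sq[OF u])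
    ultimately show ?thesis
      by (simp only: ennreal_leI)
  qed
  have "(\<integral>\<^sup>+x. (\<Sum>k. ennreal (2 ^ k * (cmod (u k x))\<^sup>2)) \<partial>M) =
      (\<Sum>k. \<integral>\<^sup>+x. ennreal (2 ^ k * (cmod (u k x))\<^sup>2) \<partial>M)"
    by (rule nn_integral_suminf) measurable
  also have "\<dots> \<le> (\<Sum>k. ennreal ((1/2) ^ k))"
    by (intro suminf_le step) auto
  also have "\<dots> = ennreal (\<Sum>k. (1/2) ^ k)"
    by (rule suminf_ennreal2) (auto intro: summable_geometric)
  also have "\<dots> < \<infinity>"
    by simp
  finally have "AE x in M. (\<Sum>k. ennreal (2 ^ k * (cmod (u k x))\<^sup>2)) \<noteq> \<infinity>"
    by (intro nn_integral_PInf_AE) auto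
  then have conv: "AE x in M. (\<lambda>k. X (r k) x) \<longlonglongrightarrow> lim (\<lambda>k. X (r k) x)"
  proof eventually_elim
    case (elim x)
    have sm: "summable (\<lambda>k. 2 ^ k * (cmod (u k x))\<^sup>2)"
      using elim by (intro summable_suminf_not_top) auto
    have "summable (\<lambda>k. u k x)"
    proof (rule summable_norm_cancel, rule summable_comparison_test')
      show "summable (\<lambda>k. (1/2) ^ k + 2 ^ k * (cmod (u k x))\<^sup>2)"
        by (intro summable_add sm summable_geometric) simp
      show "norm (norm (u k x)) \<le> (1/2) ^ k + 2 ^ k * (cmod (u k x))\<^sup>2" for k
      proof -
        define s :: real where "s = 2 ^ k"
        have s: "0 < s"
          by (simp add: s_def)
        have "2 * (cmod (u k x) * s) \<le> (cmod (u k x) * s)\<^sup>2 + 1"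
          using sum_squares_bound[of "cmod (u k x) * s" 1] by simp
        then have "cmod (u k x) * s \<le> (cmod (u k x) * s)\<^sup>2 + 1"
          using s mult_nonneg_nonneg[OF norm_ge_zero, of s "u k x"] by linarith
        moreover have "(1 / s + s * (cmod (u k x))\<^sup>2) * s = (cmod (u k x) * s)\<^sup>2 + 1"
          using s by (simp add: field_simps power2_eq_square)
        ultimately have "cmod (u k x) * s \<le> (1 / s + s * (cmod (u k x))\<^sup>2) * s"
          by simp
        then have "cmod (u k x) \<le> 1 / s + s * (cmod (u k x))\<^sup>2"
          using s by (rule mult_right_le_imp_le)
        then show ?thesis
          by (simp add: s_def power_one_over)
      qed
    qed
    then have "convergent (\<lambda>n. \<Sum>k<n. u k x)"
      by (simp add: summable_iff_convergent)
    moreover have "(\<Sum>k<n. u k x) = X (r n) x - X (r 0) x" for n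
      using sum_lessThan_telescope[of "\<lambda>k. X (r k) x" n] by (simp add: u_def pdiff_apply)
    ultimately have "convergent (\<lambda>n. X (r n) x - X (r 0) x)"
      by simp
    then have "convergent (\<lambda>n. X (r n) x)"
      by (simp add: convergent_diff_const_right_iff)
    then show ?case
      by (simp add: convergent_LIMSEQ_iff)
  qed
  define f where "f x = lim (\<lambda>k. X (r k) x)" for x
  have [measurable]: "f \<in> borel_measurable M"
    unfolding f_def by measurable
  have fatou: "(\<integral>\<^sup>+x. ennreal ((cmod (X n x - f x))\<^sup>2) \<partial>M) \<le> ennreal (e\<^sup>2)"
    if n: "\<forall>m\<ge>K. l2nrm M (pdiff (X n) (X m)) < e" for n K e
  proof -
    have "(\<integral>\<^sup>+x. ennreal ((cmod (X n x - f x))\<^sup>2) \<partial>M) =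
        (\<integral>\<^sup>+x. liminf (\<lambda>k. ennreal ((cmod (X n x - X (r k) x))\<^sup>2)) \<partial>M)"
    proof (rule nn_integral_cong_AE)
      show "AE x in M. ennreal ((cmod (X n x - f x))\<^sup>2) =
          liminf (\<lambda>k. ennreal ((cmod (X n x - X (r k) x))\<^sup>2))"
        using conv
      proof eventually_elim
        case (elim x)
        then have "(\<lambda>k. ennreal ((cmod (X n x - X (r k) x))\<^sup>2)) \<longlonglongrightarrow> ennreal ((cmod (X n x - f x))\<^sup>2)"
          unfolding f_def by (intro tendsto_intros)
        then show ?case
          by (metis lim_imp_Liminf trivial_limit_sequentially)
      qed
    qed
    also have "\<dots> \<le> liminf (\<lambda>k. \<integral>\<^sup>+x. ennreal ((cmod (X n x - X (r k) x))\<^sup>2) \<partial>M)"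
      by (rule nn_integral_liminf) measurable
    also have "\<dots> \<le> limsup (\<lambda>k. \<integral>\<^sup>+x. ennreal ((cmod (X n x - X (r k) x))\<^sup>2) \<partial>M)"
      by (rule Liminf_le_Limsup) simp
    also have "\<dots> \<le> ennreal (e\<^sup>2)"
    proof (rule Limsup_bounded)
      have "(\<integral>\<^sup>+x. ennreal ((cmod (X n x - X (r k) x))\<^sup>2) \<partial>M) \<le> ennreal (e\<^sup>2)" if "k \<ge> K" for k
      proof -
        have "r k \<ge> K"
          using that by (simp add: r_def)
        then have "(l2nrm M (pdiff (X n) (X (r k))))\<^sup>2 \<le> e\<^sup>2"
          using n by (intro power_mono l2nrm_nonneg) (auto intro: less_imp_le)
        then show ?thesis
          using nn_integral_sq[OF l2.diff_closed[OF X X], of n "r k"]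
          by (simp add: pdiff_apply ennreal_leI)
      qed
      then show "\<forall>\<^sub>F k in sequentially. (\<integral>\<^sup>+x. ennreal ((cmod (X n x - X (r k) x))\<^sup>2) \<partial>M) \<le> ennreal (e\<^sup>2)"
        unfolding eventually_sequentially by blast
    qed
    finally show ?thesis .
  qed
  have diff_sq: "pdiff (X n) f \<in> sq_integrable M" if "\<forall>m\<ge>K. l2nrm M (pdiff (X n) (X m)) < e" for n K e
  proof (rule sq_integrableI)
    show "integrable M (\<lambda>x. (cmod (pdiff (X n) f x))\<^sup>2)"
      unfolding pdiff_apply
    proof (rule integrableI_bounded)
      show "(\<integral>\<^sup>+x. ennreal (norm ((cmod (X n x - f x))\<^sup>2)) \<partial>M) < \<infinity>"
        using fatou[OF that] by (simp add: le_less_trans)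
    qed measurable
  qed (simp add: pdiff_apply)
  have f: "f \<in> sq_integrable M"
  proof -
    obtain K where "\<forall>m\<ge>K. l2nrm M (pdiff (X K) (X m)) < 1"
      using Cauchy[of 1] by auto
    then have "pdiff (X K) (pdiff (X K) f) \<in> sq_integrable M"
      using X by (intro l2.diff_closed diff_sq)
    then show ?thesis
      by (simp add: pdiff_apply)
  qed
  have "(\<lambda>n. l2nrm M (pdiff (X n) f)) \<longlonglongrightarrow> 0"
  proof (rule LIMSEQ_I)
    fix e :: real
    assume e: "0 < e"
    obtain K where K: "\<forall>m\<ge>K. \<forall>n\<ge>K. l2nrm M (pdiff (X m) (X n)) < e / 2"
      using Cauchy[of "e / 2"] e by auto
    have "norm (l2nrm M (pdiff (X n) f) - 0) < e" if "n \<ge> K" for n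
    proof -
      have "ennreal ((l2nrm M (pdiff (X n) f))\<^sup>2) \<le> ennreal ((e / 2)\<^sup>2)"
        using fatou[of K n "e / 2"] nn_integral_sq[OF l2.diff_closed[OF X f], of n] K that
        by (simp add: pdiff_apply)
      then have "(l2nrm M (pdiff (X n) f))\<^sup>2 \<le> (e / 2)\<^sup>2"
        by (subst (asm) ennreal_le_iff) auto
      then have "l2nrm M (pdiff (X n) f) \<le> e / 2"
        by (rule power2_le_imp_le) (use e in simp)
      then show ?thesis
        using e l2nrm_nonneg[of M "pdiff (X n) f"] by simp
    qed
    then show "\<exists>K. \<forall>n\<ge>K. norm (l2nrm M (pdiff (X n) f) - 0) < e"
      by blast
  qed
  with f show ?thesis
    by blast
qed

interpretation l2: semi_hilbert_space "sq_integrable M" padd pscale "l2ip M" for M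
  by unfold_locales (rule riesz_fischer)

definition zero_mean :: "'a measure \<Rightarrow> ('a \<Rightarrow> complex) set" where
  "zero_mean M = {f \<in> sq_integrable M. (\<integral>x. f x \<partial>M) = 0}"

lemma (in finite_measure) one_sq_integrable: "(\<lambda>x. 1) \<in> sq_integrable M"
  by (simp add: sq_integrable_def)

lemma l2ip_one: "l2ip M f (\<lambda>x. 1) = (\<integral>x. f x \<partial>M)"
  by (simp add: l2ip_def)

text \<open>Integral zero means orthogonality to the constant 1, a condition that is preserved by limits.\<close>

lemma (in finite_measure) zero_mean_semi_hilbert:
  "semi_hilbert_space (zero_mean M) padd pscale (l2ip M)"
proof -
  have zm: "f \<in> zero_mean M \<longleftrightarrow> f \<in> sq_integrable M \<and> l2ip M f (\<lambda>x. 1) = 0" for f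
    by (simp add: zero_mean_def l2ip_one)
  interpret Z: semi_inner_space "zero_mean M" padd pscale "l2ip M"
  proof
    show "zero_mean M \<noteq> {}"
      using sq_integrable_const_zero[of M] by (auto simp: zero_mean_def intro!: exI[of _ "\<lambda>x. 0"])
    show "cnj (l2ip M f g) = l2ip M g f" if "f \<in> zero_mean M" "g \<in> zero_mean M" for f g
      using that by (intro l2.ip_cnj) (auto simp: zm)
  qed (auto simp: zm l2.ip_expand l2.closed one_sq_integrable l2.ip_nonneg)
  show ?thesis
  proof
    fix X :: "nat \<Rightarrow> 'a \<Rightarrow> complex"
    assume X: "\<And>n. X n \<in> zero_mean M"
      and C: "\<And>e. 0 < e \<Longrightarrow> \<exists>N. \<forall>m\<ge>N. \<forall>n\<ge>N. l2nrm M (pdiff (X m) (X n)) < e"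
    have Xsq: "X n \<in> sq_integrable M" for n
      using X by (simp add: zm)
    obtain f where f: "f \<in> sq_integrable M" and lim: "(\<lambda>n. l2nrm M (pdiff (X n) f)) \<longlonglongrightarrow> 0"
      using riesz_fischer[OF Xsq C] by auto
    have le: "cmod (l2ip M f (\<lambda>x. 1)) \<le> l2nrm M (pdiff (X n) f) * l2nrm M (\<lambda>x. 1)" for n
      using l2.cauchy_schwarz[OF l2.diff_closed[OF Xsq f] one_sq_integrable, of n] X[of n]
        f Xsq[of n] by (simp add: l2.ip_diff_left one_sq_integrable zm)
    have "cmod (l2ip M f (\<lambda>x. 1)) \<le> 0"
      using tendsto_mult_left_zero[OF lim, of "l2nrm M (\<lambda>x. 1)"] le
      by (intro LIMSEQ_le_const) auto
    then show "\<exists>x\<in>zero_mean M. (\<lambda>n. l2nrm M (pdiff (X n) x)) \<longlonglongrightarrow> 0"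
      using f lim by (intro bexI[of _ f]) (auto simp: zm)
  qed
qed

section \<open>Translations, and passing to classes\<close>

definition shift :: "('g::group_add \<Rightarrow> 'x \<Rightarrow> 'x) \<Rightarrow> 'g \<Rightarrow> ('x \<Rightarrow> complex) \<Rightarrow> 'x \<Rightarrow> complex" where
  "shift act g f = (\<lambda>x. f (act (- g) x))"

locale mp_action =
  fixes M :: "'x measure" and act :: "'g::group_add \<Rightarrow> 'x \<Rightarrow> 'x"
  assumes mp: "measure_preserving_action M act"
begin

lemma act_zero: "x \<in> space M \<Longrightarrow> act 0 x = x"
  and act_add: "x \<in> space M \<Longrightarrow> act (g + h) x = act g (act h x)"
  and act_measurable [measurable]: "act g \<in> measurable M M"
  and distr_act: "distr M M (act g) = M"
  using mp by (auto simp: measure_preserving_action_def)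

lemma act_in_space: "x \<in> space M \<Longrightarrow> act g x \<in> space M"
  using measurable_space[OF act_measurable] by blast

lemma act_uminus: "x \<in> space M \<Longrightarrow> act (- g) (act g x) = x" "x \<in> space M \<Longrightarrow> act g (act (- g) x) = x"
  by (simp_all add: act_add[symmetric] act_zero)

lemma act_image: "A \<in> sets M \<Longrightarrow> act g ` A = act (- g) -` A \<inter> space M"
  using sets.sets_into_space[of A M] by (force simp: act_uminus act_in_space)

lemma integral_act:
  fixes F :: "'x \<Rightarrow> 'b::{banach, second_countable_topology}"
  shows "F \<in> borel_measurable M \<Longrightarrow> (\<integral>x. F (act g x) \<partial>M) = (\<integral>x. F x \<partial>M)"
  using integral_distr[OF act_measurable, where f = F and ?g1 = g] by (simp add: distr_act)

lemma integrable_act: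
  fixes F :: "'x \<Rightarrow> 'b::{banach, second_countable_topology}"
  shows "integrable M F \<Longrightarrow> integrable M (\<lambda>x. F (act g x))"
  using integrable_distr[OF act_measurable, where f = F and ?g1 = g] by (simp add: distr_act)

lemma shift_sq_integrable:
  assumes "f \<in> sq_integrable M" shows "shift act g f \<in> sq_integrable M"
proof -
  have [measurable]: "f \<in> borel_measurable M"
    using assms by (rule sq_integrableD)
  show ?thesis
    unfolding shift_def sq_integrable_def
    using integrable_act[OF sq_integrableD(2)[OF assms]] by simp
qed

lemma shift_zero_mean: "f \<in> zero_mean M \<Longrightarrow> shift act g f \<in> zero_mean M"
  using shift_sq_integrable[of f g] integral_act[where F = f and g = "- g"]
  by (auto simp: zero_mean_def shift_def dest: sq_integrableD)

lemma l2ip_shift_zero: "l2ip M (shift act 0 f) h = l2ip M f h"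
  unfolding l2ip_def shift_def by (intro Bochner_Integration.integral_cong) (auto simp: act_zero)

text \<open>This is where invariance of the measure is used: substitute \<open>g\<inverse> x\<close> for \<open>x\<close>.\<close>

lemma l2ip_shift_add:
  assumes f: "f \<in> sq_integrable M" and k: "k \<in> sq_integrable M"
  shows "l2ip M (shift act (g + h) f) k = l2ip M (shift act h f) (shift act (- g) k)"
proof -
  note [measurable] = sq_integrableD(1)[OF f] sq_integrableD(1)[OF k]
  have "l2ip M (shift act h f) (shift act (- g) k) = (\<integral>x. f (act (- h) x) * cnj (k (act g x)) \<partial>M)"
    by (simp add: l2ip_def shift_def)
  also have "\<dots> = (\<integral>x. f (act (- h) (act (- g) x)) * cnj (k (act g (act (- g) x))) \<partial>M)"
    by (rule integral_act[symmetric]) measurable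
  also have "\<dots> = l2ip M (shift act (g + h) f) k"
    unfolding l2ip_def shift_def
    by (intro Bochner_Integration.integral_cong)
       (auto simp: act_uminus minus_add act_add simp del: add_uminus_conv_diff)
  finally show ?thesis ..
qed

lemma AE_act:
  assumes "AE x in M. P x" shows "AE x in M. P (act g x)"
proof -
  have "AE x in distr M M (act g). P x"
    unfolding distr_act using assms .
  then show ?thesis
    by (rule AE_distrD[OF act_measurable])
qed

end

abbreviation l2class :: "'a measure \<Rightarrow> ('a \<Rightarrow> complex) \<Rightarrow> 'a l2" where
  "l2class M f \<equiv> ae_rel M `` {f}"

lemma l2class_eqI: "(f, g) \<in> ae_rel M \<Longrightarrow> l2class M f = l2class M g"
  using equiv_ae_rel by (rule equiv_class_eq)

lemma l2class_self: "f \<in> sq_integrable M \<Longrightarrow> f \<in> l2class M f"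
  using equiv_ae_rel by (rule equiv_class_self)

lemma l2class_in_L2: "f \<in> sq_integrable M \<Longrightarrow> l2class M f \<in> L2 M"
  unfolding L2_def by (rule quotientI)

lemma L2_E:
  assumes "\<xi> \<in> L2 M" obtains f where "f \<in> sq_integrable M" "\<xi> = l2class M f"
  using assms unfolding L2_def by (rule quotientE)

lemma l2class_in_L2_0:
  assumes "f \<in> zero_mean M" shows "l2class M f \<in> L2_0 M"
proof -
  have f: "f \<in> sq_integrable M" "(\<integral>x. f x \<partial>M) = 0"
    using assms by (auto simp: zero_mean_def)
  have "(\<integral>x. f' x \<partial>M) = 0" if "f' \<in> l2class M f" for f'
  proof -
    have "AE x in M. f' x = f x" "f' \<in> borel_measurable M" "f \<in> borel_measurable M"
      using that by (auto simp: ae_rel_def sq_integrable_def)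
    then show ?thesis
      using f(2) integral_cong_AE[of f' M f] by simp
  qed
  then show ?thesis
    using l2class_in_L2[OF f(1)] by (simp add: L2_0_def)
qed

lemma L2_0_E:
  assumes "\<xi> \<in> L2_0 M" obtains f where "f \<in> zero_mean M" "\<xi> = l2class M f"
proof -
  obtain f where "f \<in> sq_integrable M" "\<xi> = l2class M f"
    using assms L2_E by (auto simp: L2_0_def)
  then show ?thesis
    using assms l2class_self that by (fastforce simp: L2_0_def zero_mean_def)
qed

lemma l2_inner_l2class:
  "f \<in> sq_integrable M \<Longrightarrow> g \<in> sq_integrable M \<Longrightarrow> l2_inner M (l2class M f) (l2class M g) = l2ip M f g"
  by (simp add: l2_inner_class l2ip_def)

lemma l2_norm_l2class: "f \<in> sq_integrable M \<Longrightarrow> l2_norm M (l2class M f) = l2nrm M f"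
  by (simp add: l2_norm_def l2_inner_l2class l2.nrm_def)

lemma l2_scale_l2class:
  assumes f: "f \<in> sq_integrable M"
  shows "l2_scale M c (l2class M f) = l2class M (pscale c f)"
proof -
  have "(\<lambda>f. l2class M (pscale c f)) respects ae_rel M"
  proof (rule congruentI, rule l2class_eqI)
    fix f g assume fg: "(f, g) \<in> ae_rel M"
    then have "AE x in M. f x = g x"
      by (simp add: ae_rel_def)
    then have "AE x in M. pscale c f x = pscale c g x"
      by eventually_elim (simp add: pscale_def)
    then show "(pscale c f, pscale c g) \<in> ae_rel M"
      using fg by (auto simp: ae_rel_def sq_integrable_pscale)
  qed
  from UN_equiv_class[OF equiv_ae_rel this f] show ?thesis
    by (simp add: l2_scale_def pscale_def)
qed

lemma l2_add_l2class:
  assumes f: "f \<in> sq_integrable M" and g: "g \<in> sq_integrable M"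
  shows "l2_add M (l2class M f) (l2class M g) = l2class M (padd f g)"
proof -
  have "congruent2 (ae_rel M) (ae_rel M) (\<lambda>f g. l2class M (padd f g))"
  proof (rule congruent2I'[OF l2class_eqI])
    fix f f' g g' assume fg: "(f, f') \<in> ae_rel M" "(g, g') \<in> ae_rel M"
    then have "AE x in M. f x = f' x" "AE x in M. g x = g' x"
      by (simp_all add: ae_rel_def)
    then have "AE x in M. padd f g x = padd f' g' x"
      by eventually_elim (simp add: padd_def)
    then show "(padd f g, padd f' g') \<in> ae_rel M"
      using fg by (auto simp: ae_rel_def sq_integrable_padd)
  qed
  from UN_equiv_class2[OF equiv_ae_rel equiv_ae_rel this f g] show ?thesis
    by (simp add: l2_add_def padd_def)
qed

lemma l2_dist_l2class:
  "f \<in> sq_integrable M \<Longrightarrow> g \<in> sq_integrable M \<Longrightarrow>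
    l2_dist M (l2class M f) (l2class M g) = l2nrm M (pdiff f g)"
  by (simp add: l2_dist_def l2_scale_l2class l2_add_l2class l2.closed l2_norm_l2class
      l2.diff_def)

lemma (in mp_action) translation_rep_l2class:
  assumes f: "f \<in> sq_integrable M"
  shows "translation_rep M act g (l2class M f) = l2class M (shift act g f)"
proof -
  have "(\<lambda>f. l2class M (shift act g f)) respects ae_rel M"
  proof (rule congruentI, rule l2class_eqI)
    fix f f' assume ff: "(f, f') \<in> ae_rel M"
    then have "AE x in M. f x = f' x"
      by (simp add: ae_rel_def)
    then have "AE x in M. shift act g f x = shift act g f' x"
      unfolding shift_def by (rule AE_act)
    then show "(shift act g f, shift act g f') \<in> ae_rel M"
      using ff by (auto simp: ae_rel_def shift_sq_integrable)
  qed
  from UN_equiv_class[OF equiv_ae_rel this f] show ?thesis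
    by (simp add: translation_rep_def shift_def)
qed

text \<open>A supremum of reals is only meaningful if bounded above, which boundedness of the operator
  provides.\<close>

lemma op_norm_upper:
  assumes b: "bounded_op M H T" and H: "H \<subseteq> L2 M" and x: "\<xi> \<in> H" "l2_norm M \<xi> \<le> 1"
  shows "l2_norm M (T \<xi>) \<le> op_norm M H T"
  unfolding op_norm_def
proof (rule cSUP_upper)
  show "\<xi> \<in> {\<xi> \<in> H. l2_norm M \<xi> \<le> 1}"
    using x by simp
  obtain C where C: "\<And>\<xi>. \<xi> \<in> H \<Longrightarrow> l2_norm M (T \<xi>) \<le> C * l2_norm M \<xi>"
    using b unfolding bounded_op_def by blast
  show "bdd_above ((\<lambda>\<xi>. l2_norm M (T \<xi>)) ` {\<xi> \<in> H. l2_norm M \<xi> \<le> 1})"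
  proof (rule bdd_aboveI2)
    fix \<zeta> assume z: "\<zeta> \<in> {\<xi> \<in> H. l2_norm M \<xi> \<le> 1}"
    then obtain p where "p \<in> sq_integrable M" "\<zeta> = l2class M p"
      using H L2_E by blast
    then have "0 \<le> l2_norm M \<zeta>"
      by (simp add: l2_norm_l2class l2nrm_nonneg)
    then have "C * l2_norm M \<zeta> \<le> \<bar>C\<bar> * 1"
      using z by (intro mult_mono) auto
    then show "l2_norm M (T \<zeta>) \<le> \<bar>C\<bar>"
      using C[of \<zeta>] z by simp
  qed
qed

text \<open>The integrated operator enters the argument only through the sesquilinear form that
  defines it; this is how its norm bounds the form.\<close>

lemma (in mp_action) integrated_form_le_op_norm:
  assumes T: "is_integrated_op M H (translation_rep M act) \<mu> T"
    and H: "H \<subseteq> L2 M"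
    and V: "V \<subseteq> sq_integrable M" "\<And>f. f \<in> V \<Longrightarrow> l2class M f \<in> H" "\<And>c f. f \<in> V \<Longrightarrow> pscale c f \<in> V"
    and f: "f \<in> V" and k: "k \<in> V"
  shows "cmod (\<integral>g. l2ip M (shift act g f) k \<partial>\<mu>) \<le> op_norm M H T * l2nrm M f * l2nrm M k"
proof (cases "l2nrm M f = 0")
  case True
  have "cmod (l2ip M (shift act g f) k) \<le> 0" for g
  proof -
    have [measurable]: "f \<in> borel_measurable M"
      using f V(1) by (auto dest: sq_integrableD)
    have "(l2nrm M (shift act g f))\<^sup>2 = (l2nrm M f)\<^sup>2"
      unfolding l2nrm_sq shift_def by (rule integral_act) measurable
    then show ?thesis
      using l2.cauchy_schwarz[OF shift_sq_integrable, of f k g] f k V(1) True by auto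
  qed
  then have "(\<lambda>g. l2ip M (shift act g f) k) = (\<lambda>g. 0)"
    by auto
  then show ?thesis
    using True by simp
next
  case False
  \<comment> \<open>The operator norm sees the unit ball, so \<open>f\<close> is normalised first.\<close>
  define c where "c = complex_of_real (1 / l2nrm M f)"
  have c: "c \<noteq> 0" "cmod c = 1 / l2nrm M f"
    using False l2nrm_nonneg[of M f] by (simp_all add: c_def norm_divide)
  define f' where "f' = pscale c f"
  have sq: "f \<in> sq_integrable M" "k \<in> sq_integrable M" "f' \<in> sq_integrable M" "f' \<in> V"
    using f k V by (auto simp: f'_def)
  have nf': "l2nrm M f' = 1"
    using sq(1) False by (simp add: f'_def l2.nrm_scale c)
  have b: "bounded_op M H T" 
    using T by (simp add: is_integrated_op_def)
  then have "T (l2class M f') \<in> H"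
    using V(2)[OF sq(4)] by (auto simp: bounded_op_def)
  then obtain h where h: "h \<in> sq_integrable M" "T (l2class M f') = l2class M h"
    using H L2_E by blast
  have "l2_norm M (T (l2class M f')) \<le> op_norm M H T"
    using V(2)[OF sq(4)] nf' sq by (intro op_norm_upper[OF b H]) (simp_all add: l2_norm_l2class)
  then have "l2nrm M h \<le> op_norm M H T"
    using h by (simp add: l2_norm_l2class)
  moreover have "l2ip M h k = c * (\<integral>g. l2ip M (shift act g f) k \<partial>\<mu>)"
  proof -
    have "l2_inner M (T (l2class M f')) (l2class M k)
        = (\<integral>g. l2_inner M (translation_rep M act g (l2class M f')) (l2class M k) \<partial>\<mu>)"
      using T V(2) sq(4) k by (simp add: is_integrated_op_def)
    then have "l2ip M h k = (\<integral>g. l2ip M (shift act g f') k \<partial>\<mu>)"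
      using sq h by (simp add: l2_inner_l2class translation_rep_l2class shift_sq_integrable)
    also have "\<dots> = (\<integral>g. c * l2ip M (shift act g f) k \<partial>\<mu>)"
      by (simp add: l2ip_def f'_def shift_def pscale_def mult.assoc)
    finally show ?thesis
      by simp
  qed
  moreover have "cmod (l2ip M h k) \<le> l2nrm M h * l2nrm M k"
    using h(1) sq(2) by (rule l2.cauchy_schwarz)
  ultimately have "cmod (c * (\<integral>g. l2ip M (shift act g f) k \<partial>\<mu>)) \<le> op_norm M H T * l2nrm M k"
    using mult_right_mono[OF _ l2nrm_nonneg, of "l2nrm M h" "op_norm M H T" M k] by simp
  then show ?thesis
    using False l2nrm_nonneg[of M f] by (simp add: norm_mult c divide_simps mult_ac split: if_splits)
qed

section \<open>Exponential growth rates\<close>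

text \<open>If \<open>b < a\<close>, choose \<open>r\<close> between \<open>b / a\<close> and 1. Infinitely often \<open>c n\<close> exceeds \<open>r ^ n\<close>, and then
  \<open>(r a) ^ n\<close> is at most \<open>M b ^ n\<close>, although \<open>r a > b\<close>.\<close>

lemma limsup_root_comparison:
  fixes c :: "nat \<Rightarrow> real"
  assumes c: "\<And>n. 0 \<le> c n" and lim: "limsup (\<lambda>n. ereal (root n (c n))) \<ge> 1"
    and ab: "0 \<le> a" "0 \<le> b" and le: "\<And>n. c n * a ^ n \<le> M * b ^ n"
  shows "a \<le> b"
proof (rule ccontr)
  assume "\<not> a \<le> b"
  then have less: "b < a" and a: "0 < a"
    using ab by auto
  obtain r where r: "b / a < r" "r < 1"
    using dense[of "b / a" 1] less a by auto
  have r0: "0 < r"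
    using r ab by (meson divide_nonneg_nonneg le_less_trans)
  define q where "q = b / (r * a)"
  have q: "0 \<le> q" "q < 1"
    using r r0 a ab by (auto simp: q_def field_simps)
  have "(\<lambda>n. M * q ^ n) \<longlonglongrightarrow> 0"
    using q by (intro tendsto_mult_right_zero LIMSEQ_realpow_zero)
  then have "\<forall>\<^sub>F n in sequentially. M * q ^ n < 1"
    by (rule order_tendstoD) simp
  then have "\<forall>\<^sub>F n in sequentially. ereal (root n (c n)) \<le> ereal r"
    using eventually_gt_at_top[of 0]
  proof eventually_elim
    case (elim n)
    show ?case
    proof (rule ccontr)
      assume "\<not> ereal (root n (c n)) \<le> ereal r"
      then have "r ^ n < (root n (c n)) ^ n"
        using r0 elim by (intro power_strict_mono) auto
      then have "r ^ n < c n"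
        using elim c by simp
      then have "(r * a) ^ n < c n * a ^ n"
        using a by (simp add: power_mult_distrib)
      also have "\<dots> \<le> M * b ^ n"
        by (rule le)
      also have "b = q * (r * a)"
        using r0 a by (simp add: q_def)
      finally have "(r * a) ^ n * 1 < (r * a) ^ n * (M * q ^ n)"
        by (simp add: power_mult_distrib mult_ac)
      moreover have "0 < (r * a) ^ n"
        using r0 a by simp
      ultimately have "1 < M * q ^ n"
        by (simp only: mult_less_cancel_left_pos)
      with elim show False
        by simp
    qed
  qed
  then have "limsup (\<lambda>n. ereal (root n (c n))) \<le> ereal r"
    by (rule Limsup_bounded)
  also have "ereal r < 1"
    using r by (simp add: one_ereal_def)
  finally show False
    using lim by simp
qed

section \<open>Continuity of matrix coefficients\<close>

lemma coef_measurable_if_strongly_continuous: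
  fixes act :: "'g::{group_add, topological_space} \<Rightarrow> 'x \<Rightarrow> 'x"
  assumes M: "mp_action M act" and f: "f \<in> sq_integrable M" and k: "k \<in> sq_integrable M"
    and sc: "\<And>g. ((\<lambda>h. l2nrm M (pdiff (shift act h f) (shift act g f))) \<longlongrightarrow> 0) (at g)"
  shows "(\<lambda>g. l2ip M (shift act g f) k) \<in> borel_measurable borel"
proof (rule borel_measurable_continuous_onI)
  interpret mp_action M act
    by fact
  have "((\<lambda>h. l2ip M (shift act h f) k) \<longlongrightarrow> l2ip M (shift act g f) k) (at g)" for g
  proof (rule LIM_zero_cancel, rule Lim_null_comparison)
    show "\<forall>\<^sub>F h in at g. norm (l2ip M (shift act h f) k - l2ip M (shift act g f) k)
        \<le> l2nrm M (pdiff (shift act h f) (shift act g f)) * l2nrm M k"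
      using f k l2.cauchy_schwarz[OF l2.diff_closed[OF shift_sq_integrable shift_sq_integrable], of f f k]
      by (simp add: l2.ip_diff_left shift_sq_integrable)
    show "((\<lambda>h. l2nrm M (pdiff (shift act h f) (shift act g f)) * l2nrm M k) \<longlongrightarrow> 0) (at g)"
      using sc[of g] by (rule tendsto_mult_left_zero)
  qed
  then show "continuous_on UNIV (\<lambda>g. l2ip M (shift act g f) k)"
    by (simp add: continuous_on_def)
qed

section \<open>The left regular representation\<close>

lemma compact_translate_nhds:
  fixes K :: "'g::topological_group_add set"
  assumes K: "compact K" and W: "open W" "K \<subseteq> W"
  shows "\<forall>\<^sub>F h in nhds 0. (+) h ` K \<subseteq> W"
proof -
  have "\<exists>A B. open A \<and> 0 \<in> A \<and> open B \<and> k \<in> B \<and> (\<forall>a\<in>A. \<forall>b\<in>B. a + b \<in> W)" if k: "k \<in> K" for k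
  proof -
    have "\<forall>\<^sub>F x in nhds (0::'g) \<times>\<^sub>F nhds k. fst x + snd x \<in> W"
      using tendsto_add_Pair[of 0 k] W k by (intro topological_tendstoD) auto
    then obtain P Q where "eventually P (nhds (0::'g))" "eventually Q (nhds k)"
        "\<And>x y. P x \<Longrightarrow> Q y \<Longrightarrow> x + y \<in> W"
      by (auto simp: eventually_prod_filter)
    then show ?thesis
      unfolding eventually_nhds by metis
  qed
  then obtain A B where AB: "\<And>k. k \<in> K \<Longrightarrow> open (A k) \<and> (0::'g) \<in> A k"
      "\<And>k. k \<in> K \<Longrightarrow> open (B k) \<and> k \<in> B k"
      "\<And>k a b. k \<in> K \<Longrightarrow> a \<in> A k \<Longrightarrow> b \<in> B k \<Longrightarrow> a + b \<in> W"
    by metis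
  obtain C where C: "C \<subseteq> K" "finite C" "K \<subseteq> (\<Union>k\<in>C. B k)"
    using AB(2) by (auto intro: compactE_image[OF K, of K B])
  have "\<forall>\<^sub>F h in nhds 0. \<forall>k\<in>C. h \<in> A k"
    using C AB(1) by (intro eventually_ball_finite) (auto intro: eventually_nhds_in_open)
  then show ?thesis
  proof eventually_elim
    case (elim h)
    show ?case
    proof
      fix x assume "x \<in> (+) h ` K"
      then obtain k c where "x = h + k" "c \<in> C" "k \<in> B c"
        using C by auto
      then show "x \<in> W"
        using AB(3)[of c h k] elim C by auto
    qed
  qed
qed

locale haar =
  fixes m :: "'g::{topological_group_add, t2_space} measure"
  assumes haar: "left_haar_measure m"
begin

lemma sets_m [measurable_cong, simp]: "sets m = sets borel"
  and compact_finite: "compact K \<Longrightarrow> emeasure m K < \<infinity>"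
  and outer_regular: "A \<in> sets borel \<Longrightarrow> emeasure m A = (INF U\<in>{U. open U \<and> A \<subseteq> U}. emeasure m U)"
  and inner_regular: "open U \<Longrightarrow> emeasure m U = (SUP K\<in>{K. compact K \<and> K \<subseteq> U}. emeasure m K)"
  and translate: "A \<in> sets borel \<Longrightarrow> emeasure m ((+) g ` A) = emeasure m A"
  using haar[unfolded left_haar_measure_def] by (elim conjE; simp only:)+

lemma space_m [simp]: "space m = UNIV"
  using sets_eq_imp_space_eq[OF sets_m] by simp

lemma translation_measurable: "(+) (g::'g) \<in> borel_measurable borel"
  by (rule borel_measurable_continuous_onI) (intro continuous_intros)

lemma translation_image: "(+) (g::'g) ` A = (+) (- g) -` A"
  by (auto simp: image_iff add.assoc[symmetric]) (metis add.assoc add.left_neutral right_minus)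

lemma mp_translation: "mp_action m (+)"
proof
  have "distr m m ((+) g) = m" for g
  proof (rule measure_eqI)
    fix A assume "A \<in> sets (distr m m ((+) g))"
    then have A: "A \<in> sets borel"
      by simp
    have "emeasure (distr m m ((+) g)) A = emeasure m ((+) g -` A)"
      using A translation_measurable[of g] by (subst emeasure_distr) (auto cong: measurable_cong_sets)
    also have "(+) g -` A = (+) (- g) ` A"
      using translation_image[of "- g" A] by simp
    finally show "emeasure (distr m m ((+) g)) A = emeasure m A"
      using A translate by simp
  qed simp
  then show "measure_preserving_action m (+)"
    using translation_measurable
    by (auto simp: measure_preserving_action_def add.assoc cong: measurable_cong_sets)
qed

sublocale mp_action m "(+)"
  by (rule mp_translation)

lemma compact_borel: "compact K \<Longrightarrow> K \<in> sets borel" for K :: "'g set"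
  by (intro borel_closed compact_imp_closed)

lemma outer_approx:
  assumes A: "A \<in> sets borel" "emeasure m A < \<infinity>" and e: "0 < e"
  obtains W where "open W" "A \<subseteq> W" "emeasure m W < \<infinity>" "measure m W < measure m A + e"
proof -
  have "emeasure m A = ennreal (measure m A)"
    using A by (intro emeasure_eq_ennreal_measure) auto
  then have "emeasure m A < ennreal (measure m A + e)"
    using e by (simp add: ennreal_lessI add_nonneg_pos)
  then obtain W where W: "open W" "A \<subseteq> W" "emeasure m W < ennreal (measure m A + e)"
    using outer_regular[OF A(1)] by (auto simp: INF_less_iff)
  then have fin: "emeasure m W < \<infinity>"
    by (simp add: less_top[symmetric]) (metis ennreal_less_top order.strict_trans less_irrefl)
  then have "measure m W < measure m A + e"
    using W(3) by (simp add: emeasure_eq_ennreal_measure ennreal_less_iff)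
  then show ?thesis
    using that W fin by blast
qed

lemma inner_approx:
  assumes W: "open W" "emeasure m W < \<infinity>" and e: "0 < e"
  obtains K where "compact K" "K \<subseteq> W" "measure m W - e < measure m K"
proof (cases "measure m W = 0")
  case True
  then show ?thesis
    using that[of "{}"] e by simp
next
  case False
  then have "0 < measure m W"
    by (simp add: zero_less_measure_iff)
  moreover have "emeasure m W = ennreal (measure m W)"
    using W by (intro emeasure_eq_ennreal_measure) auto
  ultimately have "ennreal (measure m W - e) < emeasure m W"
    using e by (simp add: ennreal_lessI)
  then obtain K where K: "compact K" "K \<subseteq> W" "ennreal (measure m W - e) < emeasure m K"
    using inner_regular[OF W(1)] by (auto simp: less_SUP_iff)
  then have "measure m W - e < measure m K"
    using compact_finite[OF K(1)] 
    by (simp add: emeasure_eq_ennreal_measure less_top ennreal_less_iff) 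
       (metis ennreal_leI not_less)
  then show ?thesis
    using that K by blast
qed

lemma indicator_sq_integrable:
  assumes "A \<in> sets borel" "emeasure m A < \<infinity>"
  shows "(indicator A :: 'g \<Rightarrow> complex) \<in> sq_integrable m"
proof (rule sq_integrableI)
  have "(\<lambda>x. (cmod (indicator A x))\<^sup>2) = (indicator A :: 'g \<Rightarrow> real)"
    by (auto simp: indicator_def fun_eq_iff)
  then show "integrable m (\<lambda>x. (cmod (indicator A x))\<^sup>2)"
    using assms by simp
qed (use assms in simp)

lemma l2nrm_indicator_diff:
  assumes A: "A \<in> sets borel" "emeasure m A < \<infinity>" and B: "B \<in> sets borel" "emeasure m B < \<infinity>"
  shows "(l2nrm m (pdiff (indicator A) (indicator B)))\<^sup>2 = measure m (A - B) + measure m (B - A)"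
proof -
  have "(\<lambda>x. (cmod (pdiff (indicator A) (indicator B) x))\<^sup>2)
      = (\<lambda>x. indicator (A - B) x + indicator (B - A) x :: real)"
    by (auto simp: indicator_def fun_eq_iff pdiff_apply)
  moreover have "emeasure m (A - B) \<le> emeasure m A" "emeasure m (B - A) \<le> emeasure m B"
    using A B by (auto intro!: emeasure_mono)
  then have "integrable m (indicator (A - B) :: 'g \<Rightarrow> real)"
    "integrable m (indicator (B - A) :: 'g \<Rightarrow> real)"
    using A B by (simp_all add: le_less_trans)
  ultimately show ?thesis
    by (simp add: l2nrm_sq)
qed

text \<open>By regularity, a set of finite measure differs from a suitable compact set by arbitrarily small
  measure: take an open superset of almost the same measure, then a compact subset of that. Hence the
  square-integrable functions are the closed span of the indicators of compact sets, although Haar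
  measure need not be sigma-finite.\<close>

lemma L2_induct [consumes 1, case_names ind add scale lim]:
  assumes f: "f \<in> sq_integrable m"
    and ind: "\<And>K. compact K \<Longrightarrow> P (indicator K)"
    and add: "\<And>f g. f \<in> sq_integrable m \<Longrightarrow> g \<in> sq_integrable m \<Longrightarrow> P f \<Longrightarrow> P g \<Longrightarrow> P (padd f g)"
    and scale: "\<And>c f. f \<in> sq_integrable m \<Longrightarrow> P f \<Longrightarrow> P (pscale c f)"
    and lim: "\<And>f. f \<in> sq_integrable m \<Longrightarrow>
      (\<And>e. 0 < e \<Longrightarrow> \<exists>g\<in>sq_integrable m. P g \<and> l2nrm m (pdiff f g) < e) \<Longrightarrow> P f"
  shows "P f"
proof -
  have P_ind: "P (indicator A)" if A: "A \<in> sets borel" "emeasure m A < \<infinity>" for A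
  proof (rule lim)
    show "indicator A \<in> sq_integrable m"
      using A by (rule indicator_sq_integrable)
    fix e :: real
    assume e: "0 < e"
    \<comment> \<open>The two halves of the symmetric difference each contribute less than \<open>d\<close> to the square norm.\<close>
    define d where "d = e\<^sup>2 / 2"
    have d: "0 < d"
      using e by (simp add: d_def)
    obtain W where W: "open W" "A \<subseteq> W" "emeasure m W < \<infinity>" "measure m W < measure m A + d"
      using outer_approx[OF A d] .
    obtain K where K: "compact K" "K \<subseteq> W" "measure m W - d < measure m K"
      using inner_approx[OF W(1,3) d] .
    have KB: "K \<in> sets borel" "emeasure m K < \<infinity>"
      using K compact_borel compact_finite by auto
    have fm: "X \<in> fmeasurable m" if "X \<in> sets borel" "X \<subseteq> W" for X
      using that W fmeasurableI[of W m] by (intro fmeasurableI2[of W m X]) auto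
    have "measure m (A - K) \<le> measure m (W - K)"
      using W K A KB by (intro measure_mono_fmeasurable fm) auto
    also have "\<dots> = measure m W - measure m K"
      using W K KB by (intro measure_Diff) auto
    finally have 1: "measure m (A - K) < d"
      using K by simp
    have "measure m (K - A) \<le> measure m (W - A)"
      using W K A KB by (intro measure_mono_fmeasurable fm) auto
    also have "\<dots> = measure m W - measure m A"
      using W A by (intro measure_Diff) auto
    finally have 2: "measure m (K - A) < d"
      using W by simp
    have "(l2nrm m (pdiff (indicator A) (indicator K)))\<^sup>2 < e\<^sup>2"
      unfolding l2nrm_indicator_diff[OF A KB] using 1 2 by (simp add: d_def)
    then have "l2nrm m (pdiff (indicator A) (indicator K)) < e"
      by (rule power2_less_imp_less) (use e in simp)
    then show "\<exists>g\<in>sq_integrable m. P g \<and> l2nrm m (pdiff (indicator A) g) < e"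
      using ind[OF K(1)] indicator_sq_integrable[OF KB] by blast
  qed
  have P_zero: "P (\<lambda>x. 0)"
    using ind[of "{}"] by (simp add: indicator_def[abs_def])
  have P_real: "(\<lambda>x. complex_of_real (u x)) \<in> sq_integrable m \<longrightarrow> P (\<lambda>x. complex_of_real (u x))"
    if "u \<in> borel_measurable m" "\<And>x. 0 \<le> u x" for u
    using that
  proof (induction rule: borel_measurable_induct_real)
    case (set A)
    have eq: "(\<lambda>x. complex_of_real (indicator A x)) = indicator A"
      by (auto simp: indicator_def fun_eq_iff)
    have eq2: "(\<lambda>x. (cmod (indicator A x))\<^sup>2) = (indicator A :: 'g \<Rightarrow> real)"
      by (auto simp: indicator_def fun_eq_iff)
    show ?case
    proof
      assume "(\<lambda>x. complex_of_real (indicator A x)) \<in> sq_integrable m"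
      then have "integrable m (indicator A :: 'g \<Rightarrow> real)"
        unfolding eq by (auto simp: sq_integrable_def eq2)
      then have "emeasure m A < \<infinity>"
        using set by (simp add: integrable_indicator_iff)
      then show "P (\<lambda>x. complex_of_real (indicator A x))"
        unfolding eq using set by (intro P_ind) auto
    qed
  next
    case (mult u c)
    show ?case
    proof
      assume sq: "(\<lambda>x. complex_of_real (c * u x)) \<in> sq_integrable m"
      show "P (\<lambda>x. complex_of_real (c * u x))"
      proof (cases "c = 0")
        case True
        then show ?thesis
          using P_zero by simp
      next
        case False
        have usq: "(\<lambda>x. complex_of_real (u x)) \<in> sq_integrable m"
          using sq_integrable_pscale[OF sq, of "1 / c"] False by (simp add: pscale_def)
        then show ?thesis
          using scale[OF usq, of c] mult by (simp add: pscale_def)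
      qed
    qed
  next
    case (add u v)
    show ?case
    proof
      assume sq: "(\<lambda>x. complex_of_real (v x + u x)) \<in> sq_integrable m"
      have "(\<lambda>x. complex_of_real (u x)) \<in> sq_integrable m"
        "(\<lambda>x. complex_of_real (v x)) \<in> sq_integrable m"
        using add.hyps(1-4)
        by (auto intro!: sq_integrable_bound[OF sq] simp del: of_real_add)
      then show "P (\<lambda>x. complex_of_real (v x + u x))"
        using assms(3)[of "\<lambda>x. complex_of_real (v x)" "\<lambda>x. complex_of_real (u x)"] add
        by (simp add: padd_def)
    qed
  next
    case (seq U)
    show ?case
    proof
      assume sq: "(\<lambda>x. complex_of_real (u x)) \<in> sq_integrable m"
      have U_le: "U i x \<le> u x" for i x
        using seq.hyps(3) seq.hyps(4)[of x] by (intro incseq_le[where X = "\<lambda>i. U i x"]) (auto simp: incseq_def le_fun_def)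
      have [measurable]: "u \<in> borel_measurable m" "U i \<in> borel_measurable m" for i
        using that(1) seq.hyps(1) by auto
      have Usq: "(\<lambda>x. complex_of_real (U i x)) \<in> sq_integrable m" for i
        by (rule sq_integrable_bound[OF sq]) (use U_le seq.hyps(2) order_trans[OF seq.hyps(2) U_le] in auto)
      have "(\<lambda>i. \<integral>x. (cmod (of_real (u x) - of_real (U i x)))\<^sup>2 \<partial>m) \<longlonglongrightarrow> (\<integral>x. 0 \<partial>m)"
      proof (rule integral_dominated_convergence)
        show "integrable m (\<lambda>x. (cmod (complex_of_real (u x)))\<^sup>2)"
          using sq by (rule sq_integrableD)
        show "AE x in m. (\<lambda>i. (cmod (of_real (u x) - of_real (U i x)))\<^sup>2) \<longlonglongrightarrow> 0"
        proof (rule AE_I2)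
          fix x
          have "(\<lambda>i. (cmod (of_real (u x) - of_real (U i x)))\<^sup>2) \<longlonglongrightarrow> (cmod (of_real (u x) - of_real (u x)))\<^sup>2"
            by (intro tendsto_intros seq.hyps(4)) simp
          then show "(\<lambda>i. (cmod (of_real (u x) - of_real (U i x)))\<^sup>2) \<longlonglongrightarrow> 0"
            by simp
        qed
        show "AE x in m. norm ((cmod (of_real (u x) - of_real (U i x)))\<^sup>2) \<le> (cmod (complex_of_real (u x)))\<^sup>2" for i
        proof (rule AE_I2)
          fix x
          have "cmod (of_real (u x) - of_real (U i x)) = \<bar>u x - U i x\<bar>"
            by (metis norm_of_real of_real_diff)
          then show "norm ((cmod (of_real (u x) - of_real (U i x)))\<^sup>2) \<le> (cmod (complex_of_real (u x)))\<^sup>2"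
            using U_le[of i x] seq.hyps(2)[of i x] by (auto intro!: power_mono)
        qed
      qed measurable
      then have lim0: "(\<lambda>i. (l2nrm m (pdiff (\<lambda>x. of_real (u x)) (\<lambda>x. of_real (U i x))))\<^sup>2) \<longlonglongrightarrow> 0"
        by (simp add: l2nrm_sq pdiff_apply)
      show "P (\<lambda>x. complex_of_real (u x))"
      proof (rule lim[OF sq])
        fix e :: real
        assume e: "0 < e"
        have "\<forall>\<^sub>F i in sequentially. (l2nrm m (pdiff (\<lambda>x. of_real (u x)) (\<lambda>x. of_real (U i x))))\<^sup>2 < e\<^sup>2"
          using lim0 by (rule order_tendstoD) (use e in simp)
        then obtain i where "(l2nrm m (pdiff (\<lambda>x. of_real (u x)) (\<lambda>x. of_real (U i x))))\<^sup>2 < e\<^sup>2"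
          by (auto simp: eventually_sequentially)
        then have "l2nrm m (pdiff (\<lambda>x. of_real (u x)) (\<lambda>x. of_real (U i x))) < e"
          by (rule power2_less_imp_less) (use e in simp)
        then show "\<exists>g\<in>sq_integrable m. P g \<and> l2nrm m (pdiff (\<lambda>x. of_real (u x)) g) < e"
          using Usq[of i] seq.IH[of i] by blast
      qed
    qed
  qed
  have [measurable]: "f \<in> borel_measurable m"
    using f by (rule sq_integrableD)
  \<comment> \<open>Positive and negative parts of the real and imaginary parts of \<open>f\<close>.\<close>
  define part where "part r = (\<lambda>x. complex_of_real (max 0 (r (f x))))" for r :: "complex \<Rightarrow> real"
  have part: "part r \<in> sq_integrable m" "P (part r)"
    if "\<And>z. \<bar>r z\<bar> \<le> cmod z" and [measurable]: "r \<in> borel_measurable borel" for r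
  proof -
    show 1: "part r \<in> sq_integrable m"
    proof (rule sq_integrable_bound[OF f])
      show "cmod (part r x) \<le> cmod (f x)" for x
        using that(1)[of "f x"] by (simp add: part_def)
    qed (simp add: part_def)
    have "(\<lambda>x. max 0 (r (f x))) \<in> borel_measurable m"
      by measurable
    then show "P (part r)"
      using P_real[of "\<lambda>x. max 0 (r (f x))"] 1 by (simp add: part_def)
  qed
  have split: "f = padd (padd (part Re) (pscale (-1) (part (\<lambda>z. - Re z))))
      (pscale \<i> (padd (part Im) (pscale (-1) (part (\<lambda>z. - Im z)))))"
    by (auto simp: fun_eq_iff padd_def pscale_def part_def complex_eq_iff max_def)
  have parts: "part r \<in> sq_integrable m" "P (part r)" if "r \<in> {Re, \<lambda>z. - Re z, Im, \<lambda>z. - Im z}" for r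
    using that part by (auto simp: abs_Re_le_cmod abs_Im_le_cmod)
  show ?thesis
    by (subst split) (intro assms(3) assms(4) parts l2.closed; simp)
qed

lemma shift_pdiff: "shift act h (pdiff f g) = pdiff (shift act h f) (shift act h g)"
  by (simp add: shift_def pdiff_apply)

lemma l2nrm_shift: "f \<in> sq_integrable m \<Longrightarrow> l2nrm m (shift (+) g f) = l2nrm m f"
proof -
  assume f: "f \<in> sq_integrable m"
  have [measurable]: "f \<in> borel_measurable m"
    using f by (rule sq_integrableD)
  have "(l2nrm m (shift (+) g f))\<^sup>2 = (l2nrm m f)\<^sup>2"
    unfolding l2nrm_sq shift_def by (rule integral_act) measurable
  then show ?thesis
    by (rule power2_eq_imp_eq) (rule l2nrm_nonneg)+
qed

text \<open>For the indicator of a compact set \<open>K\<close>: by outer regularity \<open>K\<close> has an open neighbourhood \<open>W\<close>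
  of barely larger measure, and small translates of \<open>K\<close> stay inside \<open>W\<close>. The property passes to the
  closed span because translations are isometries.\<close>

lemma translation_continuous_at_zero:
  assumes "f \<in> sq_integrable m"
  shows "((\<lambda>h. l2nrm m (pdiff (shift (+) h f) f)) \<longlongrightarrow> 0) (nhds 0)"
  using assms
proof (induction rule: L2_induct)
  case (ind K)
  have KB: "K \<in> sets borel" "emeasure m K < \<infinity>"
    using ind compact_borel compact_finite by auto
  show ?case
  proof (rule tendstoI)
    fix e :: real
    assume e: "0 < e"
    have d: "0 < e\<^sup>2 / 2"
      using e by simp
    obtain W where W: "open W" "K \<subseteq> W" "emeasure m W < \<infinity>" "measure m W < measure m K + e\<^sup>2 / 2"
      using outer_approx[OF KB d] .
    have "\<forall>\<^sub>F h in nhds 0. (+) h ` K \<subseteq> W"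
      using ind W by (intro compact_translate_nhds)
    then show "\<forall>\<^sub>F h in nhds 0. dist (l2nrm m (pdiff (shift (+) h (indicator K)) (indicator K))) 0 < e"
    proof eventually_elim
      case (elim h)
      define L where "L = (+) h ` K"
      have L: "L \<in> sets borel"
        using KB translation_image[of h K] measurable_sets_borel[OF translation_measurable, of K "- h"]
        by (auto simp: L_def)
      have "emeasure m L = emeasure m K"
        unfolding L_def by (rule translate[OF KB(1)])
      then have mL: "measure m L = measure m K" "emeasure m L < \<infinity>"
        using KB by (auto simp: measure_def)
      have sh: "shift (+) h (indicator K) = indicator L"
        by (auto simp: shift_def indicator_def fun_eq_iff L_def translation_image)
      have fm: "X \<in> fmeasurable m" if "X \<in> sets borel" "X \<subseteq> W" for X
        using that W fmeasurableI[of W m] by (intro fmeasurableI2[of W m X]) auto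
      have "measure m (L - K) \<le> measure m (W - K)"
        using W KB L elim by (intro measure_mono_fmeasurable fm) (auto simp: L_def)
      also have "\<dots> = measure m W - measure m K"
        using W KB by (intro measure_Diff) auto
      finally have small: "measure m (L - K) < e\<^sup>2 / 2"
        using W by simp
      have "measure m (L - K \<inter> L) = measure m L - measure m (K \<inter> L)"
        "measure m (K - K \<inter> L) = measure m K - measure m (K \<inter> L)"
        by (rule measure_Diff; use KB L mL(2) in auto)+
      \<comment> \<open>As \<open>K\<close> and its translate \<open>L\<close> have equal measure, so have both halves of their symmetric
          difference; one half lies in \<open>W - K\<close>.\<close>
      moreover have "L - K \<inter> L = L - K" "K - K \<inter> L = K - L"
        by auto
      ultimately have "measure m (K - L) = measure m (L - K)"
        using mL by simp
      then have "(l2nrm m (pdiff (indicator L) (indicator K)))\<^sup>2 < e\<^sup>2"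
        unfolding l2nrm_indicator_diff[OF L mL(2) KB] using small by simp
      then have "l2nrm m (pdiff (indicator L) (indicator K)) < e"
        by (rule power2_less_imp_less) (use e in simp)
      then show ?case
        by (simp add: sh l2nrm_nonneg)
    qed
  qed
next
  case (add f g)
  show ?case
  proof (rule Lim_null_comparison[OF always_eventually tendsto_add_zero[OF add.IH]], rule allI)
    fix h
    have "pdiff (shift (+) h (padd f g)) (padd f g)
        = padd (pdiff (shift (+) h f) f) (pdiff (shift (+) h g) g)"
      by (simp add: shift_def pdiff_apply padd_def algebra_simps)
    then show "norm (l2nrm m (pdiff (shift (+) h (padd f g)) (padd f g)))
        \<le> l2nrm m (pdiff (shift (+) h f) f) + l2nrm m (pdiff (shift (+) h g) g)"
      using l2.nrm_add_le[of "pdiff (shift (+) h f) f" m "pdiff (shift (+) h g) g"] add.hyps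
      by (simp add: l2nrm_nonneg l2.closed shift_sq_integrable)
  qed
next
  case (scale c f)
  have "l2nrm m (pdiff (shift (+) h (pscale c f)) (pscale c f)) = cmod c * l2nrm m (pdiff (shift (+) h f) f)" for h
  proof -
    have "pdiff (shift (+) h (pscale c f)) (pscale c f) = pscale c (pdiff (shift (+) h f) f)"
      by (simp add: shift_def pdiff_apply pscale_def right_diff_distrib)
    then show ?thesis
      using scale.hyps by (simp add: l2.nrm_scale l2.closed shift_sq_integrable)
  qed
  then show ?case
    using tendsto_mult_right_zero[OF scale.IH] by simp
next
  case (lim f)
  show ?case
  proof (rule tendstoI)
    fix e :: real
    assume "0 < e"
    then obtain g where g: "g \<in> sq_integrable m" "l2nrm m (pdiff f g) < e / 3"
        "((\<lambda>h. l2nrm m (pdiff (shift (+) h g) g)) \<longlongrightarrow> 0) (nhds 0)"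
      using lim.IH[of "e / 3"] by auto
    have "\<forall>\<^sub>F h in nhds 0. l2nrm m (pdiff (shift (+) h g) g) < e / 3"
      using g(3) by (rule order_tendstoD) (use \<open>0 < e\<close> in simp)
    then show "\<forall>\<^sub>F h in nhds 0. dist (l2nrm m (pdiff (shift (+) h f) f)) 0 < e"
    proof eventually_elim
      case (elim h)
      have sq: "shift (+) h f \<in> sq_integrable m" "shift (+) h g \<in> sq_integrable m"
        using lim.hyps g by (auto intro: shift_sq_integrable)
      have "l2nrm m (pdiff (shift (+) h f) f) \<le> l2nrm m (pdiff (shift (+) h f) (shift (+) h g))
          + l2nrm m (pdiff (shift (+) h g) f)"
        using sq lim.hyps by (intro l2.nrm_triangle)
      also have "l2nrm m (pdiff (shift (+) h f) (shift (+) h g)) = l2nrm m (pdiff f g)"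
        using lim.hyps g by (simp add: shift_pdiff[symmetric] l2nrm_shift l2.closed)
      also have "l2nrm m (pdiff (shift (+) h g) f) \<le> l2nrm m (pdiff (shift (+) h g) g) + l2nrm m (pdiff g f)"
        using sq lim.hyps g by (intro l2.nrm_triangle)
      also have "l2nrm m (pdiff g f) = l2nrm m (pdiff f g)"
        using g lim.hyps by (simp add: l2.nrm_diff_commute)
      finally show ?case
        using elim g by (simp add: l2nrm_nonneg)
    qed
  qed
qed

lemma left_regular_strongly_continuous:
  assumes f: "f \<in> sq_integrable m"
  shows "((\<lambda>h. l2nrm m (pdiff (shift (+) h f) (shift (+) g f))) \<longlongrightarrow> 0) (at g)"
proof -
  have "((\<lambda>h. - g + h) \<longlongrightarrow> - g + g) (at g)"
    by (intro tendsto_intros)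
  then have "filterlim (\<lambda>h. - g + h) (nhds 0) (at g)"
    by simp
  from filterlim_compose[OF translation_continuous_at_zero[OF f] this]
  have "((\<lambda>h. l2nrm m (pdiff (shift (+) (- g + h) f) f)) \<longlongrightarrow> 0) (at g)" .
  moreover have "l2nrm m (pdiff (shift (+) (- g + h) f) f) = l2nrm m (pdiff (shift (+) h f) (shift (+) g f))" for h
  proof -
    have "shift (+) h f = shift (+) g (shift (+) (- g + h) f)"
      by (simp add: shift_def minus_add add.assoc fun_eq_iff del: add_uminus_conv_diff)
    then show ?thesis
      using f by (simp add: shift_pdiff[symmetric] l2nrm_shift l2.closed shift_sq_integrable)
  qed
  ultimately show ?thesis
    by simp
qed

lemma compact_support_dense:
  assumes "f \<in> sq_integrable m" and "0 < e"
  shows "\<exists>g\<in>sq_integrable m. (\<exists>C. compact C \<and> (\<forall>x. x \<notin> C \<longrightarrow> g x = 0)) \<and> l2nrm m (pdiff f g) < e"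
  using assms
proof (induction arbitrary: e rule: L2_induct)
  case (ind K)
  have "l2nrm m (pdiff (indicator K) (indicator K)) = 0"
    by (simp add: l2.nrm_def l2ip_def pdiff_apply)
  then show ?case
    using ind indicator_sq_integrable[OF compact_borel compact_finite, OF ind(1) ind(1)]
    by (intro bexI[of _ "indicator K"]) (auto intro!: exI[of _ K])
next
  case (add f g)
  have e: "0 < e / 2"
    using add.prems by simp
  obtain f' C where f': "f' \<in> sq_integrable m" "compact C" "\<And>x. x \<notin> C \<Longrightarrow> f' x = 0"
      "l2nrm m (pdiff f f') < e / 2"
    using add.IH(1)[OF e] by blast
  obtain g' D where g': "g' \<in> sq_integrable m" "compact D" "\<And>x. x \<notin> D \<Longrightarrow> g' x = 0"
      "l2nrm m (pdiff g g') < e / 2"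
    using add.IH(2)[OF e] by blast
  have "pdiff (padd f g) (padd f' g') = padd (pdiff f f') (pdiff g g')"
    by (simp add: pdiff_apply padd_def algebra_simps)
  then have "l2nrm m (pdiff (padd f g) (padd f' g')) < e"
    using l2.nrm_add_le[of "pdiff f f'" m "pdiff g g'"] f' g' add.hyps by (simp add: l2.closed)
  moreover have "compact (C \<union> D)" "\<forall>x. x \<notin> C \<union> D \<longrightarrow> padd f' g' x = 0"
    using f' g' by (auto simp: padd_def)
  ultimately show ?case
    using f' g' by (meson l2.add_closed)
next
  case (scale c f)
  have e: "0 < e / (cmod c + 1)"
    using scale.prems by (simp add: add_nonneg_pos)
  obtain f' C where f': "f' \<in> sq_integrable m" "compact C" "\<And>x. x \<notin> C \<Longrightarrow> f' x = 0"
      "l2nrm m (pdiff f f') < e / (cmod c + 1)"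
    using scale.IH(1)[OF e] by blast
  have "pdiff (pscale c f) (pscale c f') = pscale c (pdiff f f')"
    by (simp add: pdiff_apply pscale_def right_diff_distrib)
  then have "l2nrm m (pdiff (pscale c f) (pscale c f')) = cmod c * l2nrm m (pdiff f f')"
    using f' scale.hyps by (simp add: l2.nrm_scale l2.closed)
  also have "\<dots> \<le> (cmod c + 1) * l2nrm m (pdiff f f')"
    by (intro mult_right_mono l2nrm_nonneg) simp
  also have "\<dots> < e"
  proof -
    have "0 < cmod c + 1"
      by (simp add: add_nonneg_pos)
    then show ?thesis
      using f'(4) by (simp add: pos_less_divide_eq mult.commute)
  qed
  finally have "l2nrm m (pdiff (pscale c f) (pscale c f')) < e" .
  moreover have "\<forall>x. x \<notin> C \<longrightarrow> pscale c f' x = 0"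
    using f' by (auto simp: pscale_def)
  ultimately show ?case
    using f' by (meson l2.scale_closed)
next
  case (lim f)
  have e: "0 < e / 2"
    using lim.prems by simp
  obtain g where g: "g \<in> sq_integrable m" "l2nrm m (pdiff f g) < e / 2"
      "\<And>d. 0 < d \<Longrightarrow> \<exists>h\<in>sq_integrable m. (\<exists>C. compact C \<and> (\<forall>x. x \<notin> C \<longrightarrow> h x = 0)) \<and> l2nrm m (pdiff g h) < d"
    using lim.IH[OF e] by blast
  obtain h where h: "h \<in> sq_integrable m" "\<exists>C. compact C \<and> (\<forall>x. x \<notin> C \<longrightarrow> h x = 0)"
      "l2nrm m (pdiff g h) < e / 2"
    using g(3)[OF e] by blast
  have "l2nrm m (pdiff f h) < e"
    using l2.nrm_triangle[OF lim.hyps g(1) h(1)] g(2) h(3) by simp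
  then show ?case
    using h by blast
qed

end

section \<open>Test vectors in the probability space\<close>

lemma uminus_sum_list: "- sum_list xs = sum_list (rev (map uminus xs))" for xs :: "'g::group_add list"
  by (induction xs) (simp_all add: minus_add del: add_uminus_conv_diff)

lemma product_power_uminus:
  fixes S :: "'g::group_add set"
  assumes "uminus ` S = S" "h \<in> product_power S n"
  shows "- h \<in> product_power S n"
proof -
  obtain xs where xs: "h = sum_list xs" "length xs = n" "set xs \<subseteq> S"
    using assms(2) by (auto simp: product_power_def)
  then have "set (rev (map uminus xs)) \<subseteq> S"
    using assms(1) by auto
  then show ?thesis
    using xs unfolding product_power_def by (intro CollectI exI[of _ "rev (map uminus xs)"])
      (simp add: uminus_sum_list)
qed

lemma zero_in_product_power: "0 \<in> S \<Longrightarrow> 0 \<in> product_power S n" for S :: "'a::monoid_add set"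
proof -
  have "sum_list (replicate n 0) = (0::'a)"
    by (induction n) auto
  moreover assume "0 \<in> S"
  ultimately show ?thesis
    unfolding product_power_def by (intro CollectI exI[of _ "replicate n 0"]) auto
qed

text \<open>Subtracting from the indicator of \<open>B\<close> a multiple of the indicator of the complement \<open>D\<close>
  of \<open>A\<close> makes its integral zero. As the translates of \<open>B\<close> by \<open>P\<close> stay inside \<open>A\<close>, the two parts
  never interact, and the correction can only increase the coefficient.\<close>

lemma (in mp_action) displaced_vector:
  fixes P :: "'g set"
  assumes prob: "prob_space M"
    and A: "A \<in> sets M" "measure M A < 1/2" and B: "B \<in> sets M"
    and P: "0 \<in> P" "\<And>h. h \<in> P \<Longrightarrow> - h \<in> P"
    and move: "\<And>h x. h \<in> P \<Longrightarrow> x \<in> B \<Longrightarrow> act h x \<in> A"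
  obtains \<phi> where "\<phi> \<in> zero_mean M" "(l2nrm M \<phi>)\<^sup>2 \<le> 2 * measure M B"
    "\<And>h. h \<in> P \<Longrightarrow> measure M (act h ` B \<inter> B) \<le> Re (l2ip M (shift act h \<phi>) \<phi>)"
proof -
  interpret prob_space M
    by fact
  define D where "D = space M - A"
  have D [measurable]: "D \<in> sets M"
    using A by (simp add: D_def)
  note [measurable] = A(1) B
  have mD: "1/2 < measure M D"
    using A by (simp add: D_def prob_compl)
  have BA: "B \<subseteq> A"
    using move[OF P(1)] act_zero sets.sets_into_space[OF B] by force
  then have BD: "B \<inter> D = {}"
    by (auto simp: D_def)
  \<comment> \<open>That \<open>B\<close> has smaller measure than \<open>D\<close> gives \<open>c \<le> 1\<close> below, and with it the bound on the
      norm.\<close>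
  have mB: "measure M B < 1/2"
    using finite_measure_mono[OF BA A(1)] A by simp
  define c where "c = measure M B / measure M D"
  have c: "0 \<le> c" "c \<le> 1" "c * measure M D = measure M B"
    using mD mB by (simp_all add: c_def)
  define r where "r x = indicator B x - c * indicator D x" for x
  define \<phi> where "\<phi> x = complex_of_real (r x)" for x
  have r_meas [measurable]: "r \<in> borel_measurable M"
    unfolding r_def by measurable
  have r_sq: "(cmod (\<phi> x))\<^sup>2 = indicator B x + c\<^sup>2 * indicator D x" for x
    using BD by (auto simp: \<phi>_def r_def indicator_def)
  have int: "integrable M (indicator B :: 'x \<Rightarrow> real)" "integrable M (indicator D :: 'x \<Rightarrow> real)"
    by (simp_all add: emeasure_eq_measure)
  have sq: "\<phi> \<in> sq_integrable M"
  proof (rule sq_integrableI)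
    show "\<phi> \<in> borel_measurable M"
      unfolding \<phi>_def by measurable
    show "integrable M (\<lambda>x. (cmod (\<phi> x))\<^sup>2)"
      unfolding r_sq using int by simp
  qed
  have "(\<integral>x. \<phi> x \<partial>M) = of_real (\<integral>x. r x \<partial>M)"
    unfolding \<phi>_def by simp
  also have "(\<integral>x. r x \<partial>M) = measure M B - c * measure M D"
    unfolding r_def using int by simp
  finally have zm: "\<phi> \<in> zero_mean M"
    using sq c by (simp add: zero_mean_def)
  have "(l2nrm M \<phi>)\<^sup>2 = measure M B + c * (c * measure M D)"
    unfolding l2nrm_sq r_sq using int by (simp add: power2_eq_square)
  also have "\<dots> = (1 + c) * measure M B"
    unfolding c(3) by (simp add: distrib_right)
  also have "\<dots> \<le> 2 * measure M B"
    using c by (intro mult_right_mono) auto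
  finally have nrm: "(l2nrm M \<phi>)\<^sup>2 \<le> 2 * measure M B" .
  have coef: "measure M (act h ` B \<inter> B) \<le> Re (l2ip M (shift act h \<phi>) \<phi>)" if h: "h \<in> P" for h
  proof -
    have hB [measurable]: "act h ` B \<inter> B \<in> sets M"
      using act_image[OF B, of h] measurable_sets[OF act_measurable B, of "- h"] by simp
    have "l2ip M (shift act h \<phi>) \<phi> = of_real (\<integral>x. r (act (- h) x) * r x \<partial>M)"
      by (simp add: l2ip_def shift_def \<phi>_def of_real_mult[symmetric] del: of_real_mult)
    then have eq: "Re (l2ip M (shift act h \<phi>) \<phi>) = (\<integral>x. r (act (- h) x) * r x \<partial>M)"
      by simp
    have "measure M (act h ` B \<inter> B) = (\<integral>x. indicator (act h ` B \<inter> B) x \<partial>M)"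
      by simp
    also have "\<dots> \<le> (\<integral>x. r (act (- h) x) * r x \<partial>M)"
    proof (rule integral_mono)
      show "integrable M (indicator (act h ` B \<inter> B) :: 'x \<Rightarrow> real)"
        by (simp add: emeasure_eq_measure)
      show "integrable M (\<lambda>x. r (act (- h) x) * r x)"
      proof (rule integrable_const_bound)
        have r_le: "\<bar>r x\<bar> \<le> 1" for x
          using c BD by (auto simp: r_def indicator_def)
        show "AE x in M. norm (r (act (- h) x) * r x) \<le> 1"
          using mult_mono[OF r_le r_le] by (simp add: abs_mult)
      qed measurable
      fix x assume x: "x \<in> space M"
      have mem: "x \<in> act h ` B \<longleftrightarrow> act (- h) x \<in> B"
        using x by (simp add: act_image[OF B])
      have 1: "x \<in> A" if "act (- h) x \<in> B"
        using move[OF h that] x by (simp add: act_uminus)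
      have 2: "act (- h) x \<in> A" if "x \<in> B"
        using move[OF P(2)[OF h] that] .
      show "indicator (act h ` B \<inter> B) x \<le> r (act (- h) x) * r x"
        using 1 2 BA c(1) by (auto simp: r_def D_def mem indicator_def)
    qed
    finally show ?thesis
      unfolding eq .
  qed
  show ?thesis
    using that zm nrm coef by blast
qed

lemma unitary_averageI:
  fixes act :: "'g::{group_add, topological_space} \<Rightarrow> 'x \<Rightarrow> 'x"
  assumes M: "mp_action M act" and V: "semi_hilbert_space V padd pscale (l2ip M)" "V \<subseteq> sq_integrable M"
    and closed: "\<And>f g. f \<in> V \<Longrightarrow> shift act g f \<in> V"
    and coef: "\<And>f k. f \<in> V \<Longrightarrow> k \<in> V \<Longrightarrow> (\<lambda>g. l2ip M (shift act g f) k) \<in> borel_measurable borel"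
    and \<kappa>: "finite_measure \<kappa>" "sets \<kappa> = sets borel"
  shows "unitary_average V padd pscale (l2ip M) \<kappa> (shift act)"
proof -
  interpret mp_action M act
    by fact
  show ?thesis
    using V closed coef \<kappa>
    by (auto simp: unitary_average_def unitary_average_axioms_def subset_iff l2ip_shift_zero
        intro!: l2ip_shift_add)
qed

section \<open>Comparing the regular with the Koopman representation\<close>

text \<open>In the assumptions, \<open>C\<close> bounds the norm of the averaged Koopman representation, and \<open>A n\<close> is a
  measurable set of measure less than 1/2 around the translates of \<open>B n\<close>.\<close>

locale koopman_regular =
  haar m + X: mp_action \<nu> act + X: prob_space \<nu>
  + average_pair "sq_integrable m" padd pscale "l2ip m" "zero_mean \<nu>" padd pscale "l2ip \<nu>"
      \<kappa> "shift (+)" "shift act"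
  for m :: "'g::{topological_group_add, t2_space} measure"
    and \<nu> :: "'x measure" and act :: "'g \<Rightarrow> 'x \<Rightarrow> 'x" and \<kappa> :: "'g measure" +
  fixes K S F :: "'g set" and B A :: "nat \<Rightarrow> 'x set" and c :: "nat \<Rightarrow> real" and C :: real
  assumes K: "AE g in \<kappa>. g \<in> K"
    and S: "\<And>g g'. g \<in> K \<Longrightarrow> g' \<in> K \<Longrightarrow> - g + g' \<in> S" "uminus ` S = S" "0 \<in> S"
    and F: "0 \<in> interior F"
    and B: "\<And>n. B n \<in> sets \<nu>" "\<And>n. 0 < measure \<nu> (B n)"
    and A: "\<And>n. A n \<in> sets \<nu>" "\<And>n. measure \<nu> (A n) < 1/2"
    and move: "\<And>n h x. h \<in> product_power S n \<Longrightarrow> x \<in> B n \<Longrightarrow> act h x \<in> A n"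
    and c: "\<And>n. 0 \<le> c n"
      "\<And>n g. g \<in> F \<Longrightarrow> c n * measure \<nu> (B n) \<le> measure \<nu> (act g ` B n \<inter> B n)"
      "limsup (\<lambda>n. ereal (root n (c n))) \<ge> 1"
    and C: "0 \<le> C" "\<And>f k. f \<in> zero_mean \<nu> \<Longrightarrow> k \<in> zero_mean \<nu> \<Longrightarrow>
      cmod (\<integral>g. l2ip \<nu> (shift act g f) k \<partial>\<kappa>) \<le> C * l2nrm \<nu> f * l2nrm \<nu> k"
begin

text \<open>The coefficient of a function with small support vanishes off \<open>F\<close>, so on products of \<open>n\<close>
  elements of \<open>S\<close> it is dominated by that of the displaced vector.\<close>

lemma alt_growth_small_support:
  assumes f: "f \<in> sq_integrable m" and supp: "\<And>x y. f x \<noteq> 0 \<Longrightarrow> f y \<noteq> 0 \<Longrightarrow> x - y \<in> F"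
  shows "c n * (l2nrm m (L.alt n f))\<^sup>2 \<le> (2 * (l2nrm m f)\<^sup>2) * (C\<^sup>2) ^ n"
proof -
  define P where "P = product_power S n"
  obtain \<phi> where \<phi>: "\<phi> \<in> zero_mean \<nu>" "(l2nrm \<nu> \<phi>)\<^sup>2 \<le> 2 * measure \<nu> (B n)"
      "\<And>h. h \<in> P \<Longrightarrow> measure \<nu> (act h ` B n \<inter> B n) \<le> Re (l2ip \<nu> (shift act h \<phi>) \<phi>)"
  proof -
    have "0 \<in> P" "\<And>h. h \<in> P \<Longrightarrow> - h \<in> P"
      using S by (auto simp: P_def zero_in_product_power product_power_uminus)
    moreover have "\<And>h x. h \<in> P \<Longrightarrow> x \<in> B n \<Longrightarrow> act h x \<in> A n"
      using move by (simp add: P_def)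
    ultimately show thesis
      using X.displaced_vector[OF X.prob_space_axioms A(1)[of n] A(2)[of n] B(1)[of n], of P] that
      by blast
  qed
  have "(c n * measure \<nu> (B n)) * (l2nrm m (L.alt n f))\<^sup>2 \<le> (l2nrm m f)\<^sup>2 * (l2nrm \<nu> (R.alt n \<phi>))\<^sup>2"
  proof (rule domination[OF K S(1) f \<phi>(1)])
    fix h assume h: "h \<in> product_power S n"
    have pos: "0 \<le> Re (l2ip \<nu> (shift act h \<phi>) \<phi>)"
      using \<phi>(3)[of h] h measure_nonneg[of \<nu> "act h ` B n \<inter> B n"] unfolding P_def by linarith
    show "(c n * measure \<nu> (B n)) * Re (l2ip m (shift (+) h f) f) \<le>
        (l2nrm m f)\<^sup>2 * Re (l2ip \<nu> (shift act h \<phi>) \<phi>)"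
    proof (cases "h \<in> F")
      case True
      have "Re (l2ip m (shift (+) h f) f) \<le> (l2nrm m f)\<^sup>2"
        using order_trans[OF complex_Re_le_cmod L.coef_bound[OF f f, of h]]
        by (simp add: power2_eq_square)
      then have "(c n * measure \<nu> (B n)) * Re (l2ip m (shift (+) h f) f)
          \<le> (c n * measure \<nu> (B n)) * (l2nrm m f)\<^sup>2"
        using c(1)[of n] by (intro mult_left_mono) auto
      also have "\<dots> \<le> Re (l2ip \<nu> (shift act h \<phi>) \<phi>) * (l2nrm m f)\<^sup>2"
        using c(2)[OF True, of n] \<phi>(3)[of h] h by (intro mult_right_mono) (auto simp: P_def)
      finally show ?thesis
        by (simp add: mult.commute)
    next
      case False
      have "f (- h + x) * cnj (f x) = 0" for x
      proof (rule ccontr)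
        assume "f (- h + x) * cnj (f x) \<noteq> 0"
        then have "x - (- h + x) \<in> F"
          using supp[of x "- h + x"] by simp
        moreover have "x - (- h + x) = h"
          by (metis add.assoc add_minus_cancel diff_add_cancel diff_conv_add_uminus minus_add_cancel)
        ultimately show False
          using False by simp
      qed
      then have "(\<lambda>x. f (- h + x) * cnj (f x)) = (\<lambda>x. 0)"
        by blast
      then have "l2ip m (shift (+) h f) f = 0"
        by (simp add: l2ip_def shift_def del: mult_eq_0_iff)
      then show ?thesis
        using pos by simp
    qed
  qed
  also have "\<dots> \<le> (l2nrm m f)\<^sup>2 * (C ^ n * l2nrm \<nu> \<phi>)\<^sup>2"
    using R.nrm_alt_le[OF C \<phi>(1), of n] by (intro mult_left_mono power_mono l2nrm_nonneg) auto
  also have "\<dots> = ((l2nrm m f)\<^sup>2 * (C\<^sup>2) ^ n) * (l2nrm \<nu> \<phi>)\<^sup>2"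
    by (simp add: power_mult_distrib power_mult[symmetric] mult.commute)
  also have "\<dots> \<le> ((l2nrm m f)\<^sup>2 * (C\<^sup>2) ^ n) * (2 * measure \<nu> (B n))"
    using \<phi>(2) by (intro mult_left_mono) auto
  finally have "(c n * (l2nrm m (L.alt n f))\<^sup>2) * measure \<nu> (B n)
      \<le> ((2 * (l2nrm m f)\<^sup>2) * (C\<^sup>2) ^ n) * measure \<nu> (B n)"
    by (simp add: mult_ac)
  then show ?thesis
    using B(2)[of n] by (rule mult_right_le_imp_le)
qed

lemma small_neighbourhood: "\<exists>N. open N \<and> p \<in> N \<and> (\<forall>x\<in>N. \<forall>y\<in>N. x - y \<in> F)" for p :: 'g
proof -
  have lim: "((\<lambda>x. x) \<longlongrightarrow> (p, p)) (nhds (p, p))"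
    by (rule filterlim_ident)
  have "((\<lambda>x. fst x - snd x) \<longlongrightarrow> p - p) (nhds (p, p))"
    using tendsto_diff[OF tendsto_fst[OF lim] tendsto_snd[OF lim]] by simp
  then have "\<forall>\<^sub>F x in nhds p \<times>\<^sub>F nhds p. fst x - snd x \<in> interior F"
    using F by (intro topological_tendstoD) (auto simp: nhds_prod)
  then obtain P Q where PQ: "eventually P (nhds p)" "eventually Q (nhds p)"
      "\<And>x y. P x \<Longrightarrow> Q y \<Longrightarrow> x - y \<in> interior F"
    by (auto simp: eventually_prod_filter)
  obtain U where U: "open U" "p \<in> U" "\<forall>x\<in>U. P x"
    using PQ(1) unfolding eventually_nhds by blast
  obtain V where V: "open V" "p \<in> V" "\<forall>x\<in>V. Q x"
    using PQ(2) unfolding eventually_nhds by blast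
  show ?thesis
    using U V PQ(3) interior_subset[of F] by (intro exI[of _ "U \<inter> V"]) auto
qed

text \<open>Cutting \<open>f\<close> along the cover gives finitely many functions of small support. The number of pieces
  affects the constant, not the rate.\<close>

lemma alt_growth_finite_cover:
  assumes "finite I" "f \<in> sq_integrable m" "\<And>x. f x \<noteq> 0 \<Longrightarrow> x \<in> (\<Union>p\<in>I. N p)"
    and N: "\<And>p. open (N p)" "\<And>p x y. x \<in> N p \<Longrightarrow> y \<in> N p \<Longrightarrow> x - y \<in> F"
  shows "\<exists>M. \<forall>n. c n * (l2nrm m (L.alt n f))\<^sup>2 \<le> M * (C\<^sup>2) ^ n"
  using assms(1-3)
proof (induction I arbitrary: f rule: finite_induct)
  case empty
  then show ?case
    using alt_growth_small_support[of f] by fastforce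
next
  case (insert p I)
  define f1 where "f1 x = (if x \<in> N p then f x else 0)" for x
  define f2 where "f2 x = (if x \<in> N p then 0 else f x)" for x
  have [measurable]: "f \<in> borel_measurable m" "N p \<in> sets m"
    using insert.prems N(1)[of p] by (auto dest: sq_integrableD)
  have sq: "f1 \<in> sq_integrable m" "f2 \<in> sq_integrable m"
    unfolding f1_def f2_def by (auto intro!: sq_integrable_bound[OF insert.prems(1)])
  have f: "f = padd f1 f2"
    by (auto simp: padd_def f1_def f2_def)
  have g1: "c n * (l2nrm m (L.alt n f1))\<^sup>2 \<le> (2 * (l2nrm m f1)\<^sup>2) * (C\<^sup>2) ^ n" for n
    using sq(1) by (rule alt_growth_small_support) (auto simp: f1_def N split: if_splits)
  have "x \<in> (\<Union>p\<in>I. N p)" if "f2 x \<noteq> 0" for x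
    using insert.prems(2)[of x] that by (auto simp: f2_def split: if_splits)
  from insert.IH[OF sq(2) this]
  obtain M where M: "\<forall>n. c n * (l2nrm m (L.alt n f2))\<^sup>2 \<le> M * (C\<^sup>2) ^ n" ..
  have "c n * (l2nrm m (L.alt n f))\<^sup>2 \<le> (4 * (l2nrm m f1)\<^sup>2 + 2 * M) * (C\<^sup>2) ^ n" for n
  proof -
    have "l2nrm m (L.alt n f) \<le> l2nrm m (L.alt n f1) + l2nrm m (L.alt n f2)"
      unfolding f using sq by (rule L.nrm_alt_add_le)
    then have "(l2nrm m (L.alt n f))\<^sup>2 \<le> (l2nrm m (L.alt n f1) + l2nrm m (L.alt n f2))\<^sup>2"
      by (intro power_mono l2nrm_nonneg)
    also have "\<dots> \<le> 2 * (l2nrm m (L.alt n f1))\<^sup>2 + 2 * (l2nrm m (L.alt n f2))\<^sup>2"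
      using sum_squares_bound[of "l2nrm m (L.alt n f1)" "l2nrm m (L.alt n f2)"]
      by (simp add: power2_sum)
    finally have "c n * (l2nrm m (L.alt n f))\<^sup>2
        \<le> c n * (2 * (l2nrm m (L.alt n f1))\<^sup>2 + 2 * (l2nrm m (L.alt n f2))\<^sup>2)"
      by (intro mult_left_mono c)
    also have "\<dots> = 2 * (c n * (l2nrm m (L.alt n f1))\<^sup>2) + 2 * (c n * (l2nrm m (L.alt n f2))\<^sup>2)"
      by (simp add: distrib_left)
    also have "\<dots> \<le> 2 * ((2 * (l2nrm m f1)\<^sup>2) * (C\<^sup>2) ^ n) + 2 * (M * (C\<^sup>2) ^ n)"
      using g1[of n] M[rule_format, of n] by linarith
    finally show ?thesis
      by (simp add: algebra_simps)
  qed
  then show ?case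
    by blast
qed

text \<open>The lengths of the vectors \<open>alt n f\<close> grow at least at the rate \<open>\<parallel>avg f\<parallel> / \<parallel>f\<parallel>\<close>, and, weighted by
  \<open>c n\<close>, at most at the rate \<open>C\<close>.\<close>

lemma regular_form_bound:
  assumes f: "f \<in> sq_integrable m" and D: "compact D" "\<And>x. x \<notin> D \<Longrightarrow> f x = 0"
    and k: "k \<in> sq_integrable m"
  shows "cmod (\<integral>g. l2ip m (shift (+) g f) k \<partial>\<kappa>) \<le> C * l2nrm m f * l2nrm m k"
proof (cases "l2nrm m f = 0")
  case True
  have "l2ip m (shift (+) g f) k = 0" for g
    using L.coef_bound[OF f k, of g] True by simp
  then show ?thesis
    using True by simp
next
  case False
  then have nf: "0 < l2nrm m f"
    using l2nrm_nonneg[of m f] by simp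
  obtain N where N: "\<And>p. open (N p)" "\<And>p. p \<in> N p" "\<And>p x y. x \<in> N p \<Longrightarrow> y \<in> N p \<Longrightarrow> x - y \<in> F"
    using small_neighbourhood by metis
  obtain I where I: "finite I" "D \<subseteq> (\<Union>p\<in>I. N p)"
  proof (rule compactE_image[OF D(1), of UNIV N])
    show "D \<subseteq> (\<Union>p\<in>UNIV. N p)"
      using N(2) by blast
  qed (use N(1) in auto)
  have "x \<in> (\<Union>p\<in>I. N p)" if "f x \<noteq> 0" for x
    using I(2) D(2)[of x] that by blast
  then have "\<exists>M. \<forall>n. c n * (l2nrm m (L.alt n f))\<^sup>2 \<le> M * (C\<^sup>2) ^ n"
    by (rule alt_growth_finite_cover[where N = N, OF I(1) f _ N(1) N(3)])
  then obtain M where M: "\<forall>n. c n * (l2nrm m (L.alt n f))\<^sup>2 \<le> M * (C\<^sup>2) ^ n" ..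
  define a where "a = (l2nrm m (L.avg f) / l2nrm m f)\<^sup>2"
  have "a \<le> C\<^sup>2"
  proof (rule limsup_root_comparison[OF c(1) c(3)])
    fix n
    have "(l2nrm m (L.avg f)) ^ n * l2nrm m f \<le> l2nrm m (L.alt n f) * (l2nrm m f) ^ n"
      by (rule L.nrm_alt_growth[OF f])
    then have "(l2nrm m (L.avg f) / l2nrm m f) ^ n * l2nrm m f \<le> l2nrm m (L.alt n f)"
      using nf by (simp add: power_divide pos_divide_le_eq)
    then have "((l2nrm m (L.avg f) / l2nrm m f) ^ n * l2nrm m f)\<^sup>2 \<le> (l2nrm m (L.alt n f))\<^sup>2"
      using l2nrm_nonneg by (intro power_mono mult_nonneg_nonneg zero_le_power divide_nonneg_nonneg)
    also have "((l2nrm m (L.avg f) / l2nrm m f) ^ n * l2nrm m f)\<^sup>2 = a ^ n * (l2nrm m f)\<^sup>2"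
      by (simp add: a_def power_mult_distrib power_mult[symmetric] mult.commute)
    finally have "c n * (a ^ n * (l2nrm m f)\<^sup>2) \<le> c n * (l2nrm m (L.alt n f))\<^sup>2"
      by (intro mult_left_mono c)
    also have "\<dots> \<le> M * (C\<^sup>2) ^ n"
      by (rule M[rule_format])
    finally have "(c n * a ^ n) * (l2nrm m f)\<^sup>2 \<le> M * (C\<^sup>2) ^ n"
      by (simp add: mult.assoc)
    then show "c n * a ^ n \<le> M / (l2nrm m f)\<^sup>2 * (C\<^sup>2) ^ n"
      using nf by (simp add: pos_le_divide_eq)
  qed (simp_all add: a_def)
  then have "l2nrm m (L.avg f) / l2nrm m f \<le> C"
    unfolding a_def using C(1) by (rule power2_le_imp_le)
  then have "l2nrm m (L.avg f) \<le> C * l2nrm m f"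
    using nf by (simp add: pos_divide_le_eq)
  then have "l2nrm m (L.avg f) * l2nrm m k \<le> C * l2nrm m f * l2nrm m k"
    by (intro mult_right_mono l2nrm_nonneg)
  then show ?thesis
    using L.cauchy_schwarz[OF L.avg_closed[OF f] k] L.ip_avg[OF f k] by simp
qed

end

section \<open>Compactly supported truncations\<close>

definition truncate_measure :: "'g set \<Rightarrow> 'g::topological_space measure \<Rightarrow> 'g measure" where
  "truncate_measure K \<mu> = density \<mu> (indicator K)"

lemma truncate_measure:
  assumes \<mu>: "finite_measure \<mu>" "sets \<mu> = sets borel" and K: "K \<in> sets borel"
  shows sets_truncate_measure: "sets (truncate_measure K \<mu>) = sets borel"
    and finite_truncate_measure: "finite_measure (truncate_measure K \<mu>)"
    and AE_truncate_measure: "AE g in truncate_measure K \<mu>. g \<in> K"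
    and truncate_measure_close: "\<And>F b. integrable \<mu> F \<Longrightarrow> (\<And>g. cmod (F g) \<le> b) \<Longrightarrow>
      cmod ((\<integral>g. F g \<partial>\<mu>) - (\<integral>g. F g \<partial>truncate_measure K \<mu>)) \<le> b * measure \<mu> (UNIV - K)"
proof -
  interpret finite_measure \<mu>
    by fact
  have [measurable_cong, simp]: "sets \<mu> = sets borel"
    by fact
  have sp [simp]: "space \<mu> = UNIV"
    using sets_eq_imp_space_eq[OF \<mu>(2)] by simp
  have [measurable]: "K \<in> sets borel" "K \<in> sets \<mu>"
    using K by auto
  show "sets (truncate_measure K \<mu>) = sets borel"
    by (simp add: truncate_measure_def)
  show "finite_measure (truncate_measure K \<mu>)"
  proof
    have "emeasure (truncate_measure K \<mu>) (space (truncate_measure K \<mu>)) = emeasure \<mu> K"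
      unfolding truncate_measure_def by (subst emeasure_density) auto
    then show "emeasure (truncate_measure K \<mu>) (space (truncate_measure K \<mu>)) \<noteq> \<infinity>"
      by simp
  qed
  show "AE g in truncate_measure K \<mu>. g \<in> K"
    unfolding truncate_measure_def by (subst AE_density) (auto simp: indicator_def)
  fix F :: "'a \<Rightarrow> complex" and b
  assume F: "integrable \<mu> F" and b: "\<And>g. cmod (F g) \<le> b"
  note [measurable] = borel_measurable_integrable[OF F]
  have iK: "integrable \<mu> (\<lambda>g. indicator K g *\<^sub>R F g)"
    using F by (rule integrable_mult_indicator[rotated]) simp
  have eq: "(\<lambda>g. F g - indicator K g *\<^sub>R F g) = (\<lambda>g. indicator (UNIV - K) g *\<^sub>R F g)"
    by (auto simp: indicator_def fun_eq_iff)
  have "(\<integral>g. F g \<partial>truncate_measure K \<mu>) = (\<integral>g. indicator K g *\<^sub>R F g \<partial>\<mu>)"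
    unfolding truncate_measure_def
    using integral_density[where f = F and g = "indicator K" and M = \<mu>] by (simp add: ennreal_indicator)
  then have "(\<integral>g. F g \<partial>\<mu>) - (\<integral>g. F g \<partial>truncate_measure K \<mu>)
      = (\<integral>g. F g - indicator K g *\<^sub>R F g \<partial>\<mu>)"
    using F iK by simp
  also have "\<dots> = (\<integral>g. indicator (UNIV - K) g *\<^sub>R F g \<partial>\<mu>)"
    unfolding eq ..
  also have "cmod \<dots> \<le> (\<integral>g. cmod (indicator (UNIV - K) g *\<^sub>R F g) \<partial>\<mu>)"
    by (rule integral_norm_bound)
  also have "\<dots> \<le> (\<integral>g. b * indicator (UNIV - K) g \<partial>\<mu>)"
  proof (rule integral_mono)
    have "integrable \<mu> (\<lambda>g. indicator (UNIV - K) g *\<^sub>R F g)"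
      using F by (rule integrable_mult_indicator[rotated]) simp
    then show "integrable \<mu> (\<lambda>g. cmod (indicator (UNIV - K) g *\<^sub>R F g))"
      by (rule integrable_norm)
    show "integrable \<mu> (\<lambda>g. b * indicator (UNIV - K) g)"
      by (simp add: emeasure_eq_measure)
    show "cmod (indicator (UNIV - K) g *\<^sub>R F g) \<le> b * indicator (UNIV - K) g" for g
      using b[of g] by (auto simp: indicator_def)
  qed
  also have "\<dots> = b * measure \<mu> (UNIV - K)"
    by simp
  finally show "cmod ((\<integral>g. F g \<partial>\<mu>) - (\<integral>g. F g \<partial>truncate_measure K \<mu>)) \<le> b * measure \<mu> (UNIV - K)" .
qed

lemma compact_exhaustion:
  assumes \<mu>: "finite_regular_borel_measure (\<mu> :: 'g::t2_space measure)" and e: "0 < e"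
  obtains K where "compact K" "measure \<mu> (UNIV - K) < e"
proof -
  interpret finite_measure \<mu>
    using \<mu> by (simp add: finite_regular_borel_measure_def)
  have sets [simp]: "sets \<mu> = sets borel"
    using \<mu> by (simp add: finite_regular_borel_measure_def)
  have sp [simp]: "space \<mu> = UNIV"
    using sets_eq_imp_space_eq[OF sets] by simp
  have sup: "emeasure \<mu> UNIV = (SUP K\<in>{K. compact K \<and> K \<subseteq> UNIV}. emeasure \<mu> K)"
    using \<mu> unfolding finite_regular_borel_measure_def by (elim conjE) (erule bspec, simp)
  have "\<exists>K. compact K \<and> measure \<mu> UNIV - e < measure \<mu> K"
  proof (cases "measure \<mu> UNIV = 0")
    case True
    then show ?thesis
      using e by (intro exI[of _ "{}"]) simp
  next
    case False
    then have "ennreal (measure \<mu> UNIV - e) < emeasure \<mu> UNIV"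
      using e by (simp only: emeasure_eq_measure)
        (intro ennreal_lessI, simp_all add: zero_less_measure_iff)
    then obtain K where "compact K" "ennreal (measure \<mu> UNIV - e) < emeasure \<mu> K"
      unfolding sup by (auto simp: less_SUP_iff)
    then show ?thesis
      by (intro exI[of _ K]) (auto simp: emeasure_eq_measure not_le[symmetric] intro: ennreal_leI)
  qed
  then obtain K where K: "compact K" "measure \<mu> UNIV - e < measure \<mu> K"
    by blast
  then have "measure \<mu> (UNIV - K) = measure \<mu> UNIV - measure \<mu> K"
    by (intro finite_measure_Diff) (auto intro: borel_closed compact_imp_closed)
  then show ?thesis
    using that K by simp
qed

lemma compact_symmetric_neighbourhood:
  fixes K :: "'g::{topological_group_add, t2_space} set"
  assumes lc: "locally_compact_space (euclidean :: 'g topology)" and K: "compact K"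
  obtains S where "compact S" "uminus ` S = S" "0 \<in> interior S" "0 \<in> S"
    "\<And>g g'. g \<in> K \<Longrightarrow> g' \<in> K \<Longrightarrow> - g + g' \<in> S"
proof -
  obtain W D :: "'g set" where D: "open W" "compact D" "0 \<in> W" "W \<subseteq> D"
  proof -
    have "\<exists>W D. open W \<and> compact D \<and> (0::'g) \<in> W \<and> W \<subseteq> D"
      using lc by (simp add: locally_compact_space_def)
    then show thesis
      using that by blast
  qed
  define Q where "Q = (\<lambda>p. - fst p + snd p) ` (K \<times> K)"
  have cont_uminus: "continuous_on X (uminus :: 'g \<Rightarrow> 'g)" for X
    by (intro continuous_intros)
  have "compact Q"
    unfolding Q_def by (intro compact_continuous_image compact_Times K continuous_intros)
  then have 1: "compact (D \<union> Q \<union> uminus ` (D \<union> Q))"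
    using D(2) cont_uminus by (intro compact_Un compact_continuous_image)
  have 2: "uminus ` (D \<union> Q \<union> uminus ` (D \<union> Q)) = D \<union> Q \<union> uminus ` (D \<union> Q)"
    by (auto simp: image_Un image_image)
  have 3: "0 \<in> interior (D \<union> Q \<union> uminus ` (D \<union> Q))"
    using D by (intro interiorI[of W]) auto
  have 4: "- g + g' \<in> D \<union> Q \<union> uminus ` (D \<union> Q)" if "g \<in> K" "g' \<in> K" for g g'
  proof -
    have "- g + g' \<in> Q"
      unfolding Q_def using that by (intro image_eqI[where x = "(g, g')"]) auto
    then show ?thesis
      by blast
  qed
  have 5: "0 \<in> D \<union> Q \<union> uminus ` (D \<union> Q)"
    using D by auto
  show ?thesis
    using 1 2 3 5 4 by (rule that)
qed

section \<open>Comparing the norms\<close>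

theorem proposition2:
  fixes \<nu> :: "'x measure"
    and act :: "'g::{topological_group_add,t2_space} \<Rightarrow> 'x \<Rightarrow> 'x"
    and haar :: "'g measure"
    and \<mu> :: "'g measure"
    and T :: "'x l2 \<Rightarrow> 'x l2"
    and U :: "'g l2 \<Rightarrow> 'g l2"
  assumes "prob_space \<nu>" and "atomless \<nu>"
    and "locally_compact_space (euclidean :: 'g topology)"
    and "measure_preserving_action \<nu> act"
    and "strongly_continuous \<nu> (L2_0 \<nu>) (koopman \<nu> act)"
    and "\<And>S :: 'g set. compact S \<Longrightarrow> uminus ` S = S \<Longrightarrow> 0 \<in> interior S \<Longrightarrow>
      \<exists>(F :: 'g set) (B :: nat \<Rightarrow> 'x set).
        0 \<in> interior F \<and> (\<forall>n. B n \<in> sets \<nu>) \<and>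
        (\<forall>n. measure \<nu> (B n) > 0) \<and>
        (\<forall>n. (INF A\<in>{A \<in> sets \<nu>. {act s x | s x. s \<in> product_power S n \<and> x \<in> B n} \<subseteq> A}.
                measure \<nu> A) < 1/2) \<and>
        limsup (\<lambda>n. ereal (root n
          (INF g\<in>F. measure \<nu> (act g ` B n \<inter> B n) / measure \<nu> (B n)))) \<ge> 1"
    and "left_haar_measure haar"
    and "finite_regular_borel_measure \<mu>"
    and "is_integrated_op \<nu> (L2_0 \<nu>) (koopman \<nu> act) \<mu> T"
    and "is_integrated_op haar (L2 haar) (left_regular haar) \<mu> U"
  shows "op_norm \<nu> (L2_0 \<nu>) T \<ge> op_norm haar (L2 haar) U"
proof -
  interpret prob_space \<nu>
    by fact
  interpret X: mp_action \<nu> act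
    using assms(4) by unfold_locales
  interpret G: haar haar
    using assms(7) by unfold_locales
  have \<mu>: "finite_measure \<mu>" "sets \<mu> = sets borel"
    using assms(8) by (auto simp: finite_regular_borel_measure_def)
  interpret \<mu>: finite_measure \<mu>
    by (rule \<mu>)
  define t where "t = op_norm \<nu> (L2_0 \<nu>) T"
  define b where "b = measure \<mu> (space \<mu>)"

  have zm: "zero_mean \<nu> \<subseteq> sq_integrable \<nu>"
    by (auto simp: zero_mean_def)
  have zm_scale: "pscale a f \<in> zero_mean \<nu>" if "f \<in> zero_mean \<nu>" for a f
    using that sq_integrable_pscale by (auto simp: zero_mean_def pscale_def)
  have L2_0: "L2_0 \<nu> \<subseteq> L2 \<nu>"
    by (auto simp: L2_0_def)
  have coef_X: "(\<lambda>g. l2ip \<nu> (shift act g f) k) \<in> borel_measurable borel"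
    if f: "f \<in> zero_mean \<nu>" and k: "k \<in> zero_mean \<nu>" for f k
  proof (rule coef_measurable_if_strongly_continuous[OF X.mp_action_axioms])
    fix g
    have "((\<lambda>h. l2_dist \<nu> (koopman \<nu> act h (l2class \<nu> f)) (koopman \<nu> act g (l2class \<nu> f))) \<longlongrightarrow> 0) (at g)"
      using assms(5) l2class_in_L2_0[OF f] by (auto simp: strongly_continuous_def)
    then show "((\<lambda>h. l2nrm \<nu> (pdiff (shift act h f) (shift act g f))) \<longlongrightarrow> 0) (at g)"
      using subsetD[OF zm f] by (simp add: X.translation_rep_l2class l2_dist_l2class X.shift_sq_integrable)
  qed (use f k zm in auto)
  have avg_X: "unitary_average (zero_mean \<nu>) padd pscale (l2ip \<nu>) \<kappa> (shift act)"
    if "finite_measure \<kappa>" "sets \<kappa> = sets borel" for \<kappa>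
    using X.mp_action_axioms zero_mean_semi_hilbert zm X.shift_zero_mean coef_X that
    by (rule unitary_averageI)
  have avg_G: "unitary_average (sq_integrable haar) padd pscale (l2ip haar) \<kappa> (shift (+))"
    if "finite_measure \<kappa>" "sets \<kappa> = sets borel" for \<kappa>
    using G.mp_action_axioms l2.semi_hilbert_space_axioms order_refl G.shift_sq_integrable
      coef_measurable_if_strongly_continuous[OF G.mp_action_axioms _ _ G.left_regular_strongly_continuous] that
    by (rule unitary_averageI)
  interpret XA: unitary_average "zero_mean \<nu>" padd pscale "l2ip \<nu>" \<mu> "shift act"
    by (rule avg_X[OF \<mu>])
  interpret GA: unitary_average "sq_integrable haar" padd pscale "l2ip haar" \<mu> "shift (+)"
    by (rule avg_G[OF \<mu>])

  have t_bound: "cmod (\<integral>g. l2ip \<nu> (shift act g f) k \<partial>\<mu>) \<le> t * l2nrm \<nu> f * l2nrm \<nu> k"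
    if "f \<in> zero_mean \<nu>" "k \<in> zero_mean \<nu>" for f k
    unfolding t_def using assms(9) L2_0 zm l2class_in_L2_0 zm_scale that
    by (rule X.integrated_form_le_op_norm)
  have t0: "0 \<le> t"
  proof -
    have z: "(\<lambda>x. 0) \<in> zero_mean \<nu>"
      by (simp add: zero_mean_def sq_integrable_const_zero)
    then have zc: "l2class \<nu> (\<lambda>x. 0) \<in> L2_0 \<nu>"
      by (rule l2class_in_L2_0)
    have bT: "bounded_op \<nu> (L2_0 \<nu>) T"
      using assms(9) by (simp add: is_integrated_op_def)
    have "l2_norm \<nu> (l2class \<nu> (\<lambda>x. 0)) \<le> 1"
      by (simp add: l2_norm_l2class sq_integrable_const_zero l2.nrm_def l2ip_def)
    then have "l2_norm \<nu> (T (l2class \<nu> (\<lambda>x. 0))) \<le> t"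
      unfolding t_def using bT L2_0 zc by (intro op_norm_upper)
    moreover have "T (l2class \<nu> (\<lambda>x. 0)) \<in> L2_0 \<nu>"
      using bT zc by (auto simp: bounded_op_def)
    then obtain h where "h \<in> zero_mean \<nu>" "T (l2class \<nu> (\<lambda>x. 0)) = l2class \<nu> h"
      by (rule L2_0_E)
    ultimately show ?thesis
      using l2nrm_nonneg[of \<nu> h] zm by (auto simp: l2_norm_l2class)
  qed

  \<comment> \<open>Each of the two passages between \<open>\<mu>\<close> and its truncation costs \<open>e\<close>.\<close>
  have compact_bound:
    "cmod (\<integral>g. l2ip haar (shift (+) g f) k \<partial>\<mu>) \<le> (t + 2 * e) * l2nrm haar f * l2nrm haar k"
    if e: "0 < e" and f: "f \<in> sq_integrable haar" "compact D" "\<And>x. x \<notin> D \<Longrightarrow> f x = 0"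
      and k: "k \<in> sq_integrable haar" for e f D k
  proof -
    obtain K where K: "compact K" "measure \<mu> (UNIV - K) < e"
      using compact_exhaustion[OF assms(8) e] .
    have KB: "K \<in> sets borel"
      using K by (intro borel_closed compact_imp_closed)
    define \<kappa> where "\<kappa> = truncate_measure K \<mu>"
    have \<kappa>: "finite_measure \<kappa>" "sets \<kappa> = sets borel" "AE g in \<kappa>. g \<in> K"
      unfolding \<kappa>_def using \<mu> KB
      by (rule finite_truncate_measure sets_truncate_measure AE_truncate_measure)+
    have close: "cmod ((\<integral>g. H g \<partial>\<mu>) - (\<integral>g. H g \<partial>\<kappa>)) \<le> e * r"
      if H: "integrable \<mu> H" "\<And>g. cmod (H g) \<le> r" for H r
    proof -
      have "0 \<le> r"
        using H(2)[of 0] norm_ge_zero order_trans by blast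
      then have "r * measure \<mu> (UNIV - K) \<le> r * e"
        using K by (intro mult_left_mono) auto
      then show ?thesis
        using truncate_measure_close[OF \<mu> KB H] by (simp add: \<kappa>_def mult.commute)
    qed
    obtain S where S: "compact S" "uminus ` S = S" "0 \<in> interior S" "0 \<in> S"
        "\<And>g g'. g \<in> K \<Longrightarrow> g' \<in> K \<Longrightarrow> - g + g' \<in> S"
      using compact_symmetric_neighbourhood[OF assms(3) K(1)] by metis
    obtain F B where F: "0 \<in> interior F" and B: "\<And>n. B n \<in> sets \<nu>" "\<And>n. 0 < measure \<nu> (B n)"
      and small: "\<And>n. (INF A\<in>{A \<in> sets \<nu>. {act s x | s x. s \<in> product_power S n \<and> x \<in> B n} \<subseteq> A}.
                measure \<nu> A) < 1/2"
      and lim: "limsup (\<lambda>n. ereal (root n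
          (INF g\<in>F. measure \<nu> (act g ` B n \<inter> B n) / measure \<nu> (B n)))) \<ge> 1"
      using assms(6)[OF S(1-3)] by auto
    define c where "c n = (INF g\<in>F. measure \<nu> (act g ` B n \<inter> B n) / measure \<nu> (B n))" for n
    have F0: "0 \<in> F"
      using F interior_subset by blast
    have c0: "0 \<le> c n" for n
      unfolding c_def using F0 by (intro cINF_greatest) auto
    have c_le: "c n * measure \<nu> (B n) \<le> measure \<nu> (act g ` B n \<inter> B n)" if "g \<in> F" for n g
    proof -
      have "c n \<le> measure \<nu> (act g ` B n \<inter> B n) / measure \<nu> (B n)"
        unfolding c_def using that by (intro cINF_lower bdd_belowI[of _ 0]) auto
      then show ?thesis
        using B(2)[of n] by (simp add: pos_le_divide_eq)
    qed
    have "\<exists>A. A \<in> sets \<nu> \<and> {act s x | s x. s \<in> product_power S n \<and> x \<in> B n} \<subseteq> A \<and> measure \<nu> A < 1/2" for n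
    proof -
      have "{act s x | s x. s \<in> product_power S n \<and> x \<in> B n} \<subseteq> space \<nu>"
        using sets.sets_into_space[OF B(1)] X.act_in_space by blast
      then have "{A \<in> sets \<nu>. {act s x | s x. s \<in> product_power S n \<and> x \<in> B n} \<subseteq> A} \<noteq> {}"
        by blast
      moreover have "bdd_below (measure \<nu> ` {A \<in> sets \<nu>. {act s x | s x. s \<in> product_power S n \<and> x \<in> B n} \<subseteq> A})"
        by (intro bdd_belowI[of _ 0]) auto
      ultimately show ?thesis
        using small[of n] by (subst (asm) cINF_less_iff) auto
    qed
    then have "\<exists>A. \<forall>n. A n \<in> sets \<nu> \<and> {act s x | s x. s \<in> product_power S n \<and> x \<in> B n} \<subseteq> A n \<and>
        measure \<nu> (A n) < 1/2"
      by (intro choice allI)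
    then obtain A where A: "\<forall>n. A n \<in> sets \<nu> \<and>
        {act s x | s x. s \<in> product_power S n \<and> x \<in> B n} \<subseteq> A n \<and> measure \<nu> (A n) < 1/2" ..
    interpret koopman_regular haar \<nu> act \<kappa> K S F B A c "t + e"
    proof (intro koopman_regular.intro average_pair.intro koopman_regular_axioms.intro)
      show "act h x \<in> A n" if "h \<in> product_power S n" "x \<in> B n" for n h x
        using A[rule_format, of n] that by blast
      show "cmod (\<integral>g. l2ip \<nu> (shift act g f) k \<partial>\<kappa>) \<le> (t + e) * l2nrm \<nu> f * l2nrm \<nu> k"
        if f: "f \<in> zero_mean \<nu>" and k: "k \<in> zero_mean \<nu>" for f k
      proof -
        have "cmod (\<integral>g. l2ip \<nu> (shift act g f) k \<partial>\<kappa>) \<le> cmod (\<integral>g. l2ip \<nu> (shift act g f) k \<partial>\<mu>)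
            + cmod ((\<integral>g. l2ip \<nu> (shift act g f) k \<partial>\<mu>) - (\<integral>g. l2ip \<nu> (shift act g f) k \<partial>\<kappa>))"
          by (metis norm_minus_commute norm_triangle_sub)
        also have "\<dots> \<le> t * l2nrm \<nu> f * l2nrm \<nu> k + e * (l2nrm \<nu> f * l2nrm \<nu> k)"
          using f k by (intro add_mono t_bound close XA.integrable_coef XA.coef_bound)
        finally show ?thesis
          by (simp add: algebra_simps)
      qed
      show "limsup (\<lambda>n. ereal (root n (c n))) \<ge> 1"
        unfolding c_def by (rule lim)
    qed (use avg_X avg_G \<kappa> S F B A c0 c_le t0 e G.haar_axioms X.mp_action_axioms prob_space_axioms in auto)
    have "cmod (\<integral>g. l2ip haar (shift (+) g f) k \<partial>\<mu>) \<le> cmod (\<integral>g. l2ip haar (shift (+) g f) k \<partial>\<kappa>)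
        + cmod ((\<integral>g. l2ip haar (shift (+) g f) k \<partial>\<mu>) - (\<integral>g. l2ip haar (shift (+) g f) k \<partial>\<kappa>))"
      by (metis norm_triangle_sub)
    also have "\<dots> \<le> (t + e) * l2nrm haar f * l2nrm haar k + e * (l2nrm haar f * l2nrm haar k)"
      using f k by (intro add_mono regular_form_bound close GA.integrable_coef GA.coef_bound)
    finally show ?thesis
      by (simp add: algebra_simps)
  qed

  have form_bound: "cmod (\<integral>g. l2ip haar (shift (+) g f) k \<partial>\<mu>) \<le> t * l2nrm haar f * l2nrm haar k"
    if f: "f \<in> sq_integrable haar" and k: "k \<in> sq_integrable haar" for f k
  proof -
    \<comment> \<open>Replace \<open>f\<close> by a function of compact support at distance less than \<open>e\<close>, then let \<open>e\<close> tend to 0.\<close>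
    define I where "I f = (\<integral>g. l2ip haar (shift (+) g f) k \<partial>\<mu>)" for f
    have approx: "cmod (I f) \<le> b * (e * l2nrm haar k) + (t + 2 * e) * (l2nrm haar f + e) * l2nrm haar k"
      if e: "0 < e" for e
    proof -
      obtain f' D where f': "f' \<in> sq_integrable haar" "compact D" "\<And>x. x \<notin> D \<Longrightarrow> f' x = 0"
          "l2nrm haar (pdiff f f') < e"
        using G.compact_support_dense[OF f e] by blast
      have df: "pdiff f f' \<in> sq_integrable haar"
        using f f' by (simp add: l2.closed)
      have "I f = I (pdiff f f') + I f'"
      proof -
        have "l2ip haar (shift (+) g (pdiff f f')) k = l2ip haar (shift (+) g f) k - l2ip haar (shift (+) g f') k" for g
          using f f' k by (simp add: G.shift_pdiff l2.ip_diff_left G.shift_sq_integrable)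
        then show ?thesis
          unfolding I_def using f f' k by (simp add: GA.integrable_coef)
      qed
      then have "cmod (I f) \<le> cmod (I (pdiff f f')) + cmod (I f')"
        by (simp add: norm_triangle_ineq)
      moreover have "cmod (I (pdiff f f')) \<le> b * (e * l2nrm haar k)"
      proof -
        have "cmod (I (pdiff f f')) \<le> (\<integral>g. cmod (l2ip haar (shift (+) g (pdiff f f')) k) \<partial>\<mu>)"
          unfolding I_def by (rule integral_norm_bound)
        also have "\<dots> \<le> (\<integral>g. e * l2nrm haar k \<partial>\<mu>)"
        proof (rule integral_mono)
          show "integrable \<mu> (\<lambda>g. cmod (l2ip haar (shift (+) g (pdiff f f')) k))"
            by (intro integrable_norm GA.integrable_coef df k)
          show "cmod (l2ip haar (shift (+) g (pdiff f f')) k) \<le> e * l2nrm haar k" for g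
            using GA.coef_bound[OF df k, of g] mult_right_mono[OF less_imp_le[OF f'(4)] l2nrm_nonneg[of haar k]]
            by linarith
        qed simp
        finally show ?thesis
          by (simp add: b_def)
      qed
      moreover have "cmod (I f') \<le> (t + 2 * e) * (l2nrm haar f + e) * l2nrm haar k"
      proof -
        have "f' = padd f (pscale (-1) (pdiff f f'))"
          by (simp add: padd_def pscale_def pdiff_apply)
        then have "l2nrm haar f' \<le> l2nrm haar f + l2nrm haar (pscale (-1) (pdiff f f'))"
          using l2.nrm_add_le[OF f l2.scale_closed[OF df, of "-1"]] by simp
        also have "\<dots> \<le> l2nrm haar f + e"
          using f'(4) df by (simp add: l2.nrm_scale)
        finally have "(t + 2 * e) * l2nrm haar f' * l2nrm haar k \<le> (t + 2 * e) * (l2nrm haar f + e) * l2nrm haar k"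
          using t0 e by (intro mult_right_mono mult_left_mono l2nrm_nonneg) auto
        then show ?thesis
          using compact_bound[OF e f'(1,2,3) k] unfolding I_def by linarith
      qed
      ultimately show ?thesis
        by linarith
    qed
    have "((\<lambda>e. b * (e * l2nrm haar k) + (t + 2 * e) * (l2nrm haar f + e) * l2nrm haar k)
        \<longlongrightarrow> b * (0 * l2nrm haar k) + (t + 2 * 0) * (l2nrm haar f + 0) * l2nrm haar k) (at_right 0)"
      by (intro tendsto_intros)
    moreover have "\<forall>\<^sub>F e in at_right 0. cmod (I f) \<le> b * (e * l2nrm haar k) + (t + 2 * e) * (l2nrm haar f + e) * l2nrm haar k"
      unfolding eventually_at_right_field using approx by (intro exI[of _ 1]) auto
    ultimately have "cmod (I f) \<le> b * (0 * l2nrm haar k) + (t + 2 * 0) * (l2nrm haar f + 0) * l2nrm haar k"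
      by (rule tendsto_lowerbound) simp
    then show ?thesis
      by (simp add: I_def)
  qed

  have "op_norm haar (L2 haar) U \<le> t"
    unfolding op_norm_def
  proof (rule cSUP_least)
    have "l2_norm haar (l2class haar (\<lambda>x. 0)) \<le> 1"
      by (simp add: l2_norm_l2class sq_integrable_const_zero l2.nrm_def l2ip_def)
    then show "{\<xi> \<in> L2 haar. l2_norm haar \<xi> \<le> 1} \<noteq> {}"
      using l2class_in_L2[OF sq_integrable_const_zero] by blast
    fix \<xi> assume \<xi>: "\<xi> \<in> {\<xi> \<in> L2 haar. l2_norm haar \<xi> \<le> 1}"
    then obtain f where f: "f \<in> sq_integrable haar" "\<xi> = l2class haar f"
      using L2_E by blast
    have "U \<xi> \<in> L2 haar"
      using \<xi> assms(10) by (auto simp: is_integrated_op_def bounded_op_def)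
    then obtain h where h: "h \<in> sq_integrable haar" "U \<xi> = l2class haar h"
      by (rule L2_E)
    have "l2nrm haar h \<le> t * l2nrm haar f"
    proof (rule l2.nrm_le_if_ip_le[OF h(1)])
      fix k assume k: "k \<in> sq_integrable haar"
      have "l2_inner haar (U \<xi>) (l2class haar k)
          = (\<integral>g. l2_inner haar (left_regular haar g \<xi>) (l2class haar k) \<partial>\<mu>)"
        using assms(10) \<xi> l2class_in_L2[OF k] by (simp add: is_integrated_op_def)
      then have "l2ip haar h k = (\<integral>g. l2ip haar (shift (+) g f) k \<partial>\<mu>)"
        using f h k by (simp add: l2_inner_l2class G.translation_rep_l2class G.shift_sq_integrable)
      then show "cmod (l2ip haar h k) \<le> t * l2nrm haar f * l2nrm haar k"
        using form_bound[OF f(1) k] by simp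
    qed (simp add: t0 l2nrm_nonneg)
    also have "\<dots> \<le> t * 1"
      using \<xi> f t0 by (intro mult_left_mono) (auto simp: l2_norm_l2class)
    finally show "l2_norm haar (U \<xi>) \<le> t"
      using h by (simp add: l2_norm_l2class)
  qed
  then show ?thesis
    by (simp add: t_def)
qed

end
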